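(* Let $\Lambda\subset\mathbb{C}$ be a lattice, $\mathcal{K}_\Lambda$ the field of $\Lambda$-periodic meromorphic functions on $\mathbb{C}$, $s\in\mathbb{C}$ with non-torsion image in $\mathcal{E}_\Lambda=\mathbb{C}/\Lambda$, and $\tau(f)(z)=f(z+s)$. Let $\mathcal{R}=\{\alpha_\omega : \omega\in\mathcal{E}_\Lambda/\tau\}$ be any $\tau$-pinning of $\mathcal{E}_\Lambda$, and let $f(z)\in\mathcal{K}_\Lambda$. Then $f$ is elliptically summable (i.e. $f=\tau(g)-g$ for some $g\in\mathcal{K}_\Lambda$) if and only if $\mathrm{PanOres}^{\mathcal{R}}(f,0)=0$, $\mathrm{PanOres}^{\mathcal{R}}(f,1)=0$, and $\mathrm{Ores}(f,\omega,k)=0$ for every $\omega\in\mathcal{E}_\Lambda/\tau$ and $k\geq 1$.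
   Context: For $t\in\mathbb{C}$, $\check{t}=t+\Lambda\in\mathcal{E}_\Lambda$. The set of $\tau$-orbits is $\mathcal{E}_\Lambda/\tau:=\mathcal{E}_\Lambda/\mathbb{Z}\check{s}$ (cosets of $\mathbb{Z}\check s$). A $\tau$-pinning is a choice $\mathcal{R}=\{\alpha_\omega\in\mathbb{C}:\omega\in\mathcal{E}_\Lambda/\tau\}$ with $\check\alpha_\omega\in\omega$ for each $\omega$. For $f$ meromorphic on $\mathbb{C}$, $c_k(f,\alpha)$ ($k\geq 1$) denotes the coefficient of $(z-\alpha)^{-k}$ in the Laurent expansion of $f$ at $\alpha$; for $f\in\mathcal{K}_\Lambda$ it depends only on $\check\alpha$ and is also written $c_k(f,\check\alpha)$. Orbital residue: $\mathrm{Ores}(f,\omega,k):=\sum_{\check\alpha\in\omega}c_k(f,\check\alpha)$, a finite sum over points $\check\alpha\in\omega\subset\mathcal{E}_\Lambda$. $\zeta_\Lambda(z)=\frac1z+\sum_{\lambda\in\Lambda-\{0\}}\left(\frac1{z-\lambda}+\frac1\lambda+\frac{z}{\lambda^2}\right)$ is the Weierstrass zeta function. For each $f\in\mathcal{K}_\Lambda$ there is a unique constant $c_0^{\mathcal{R}}(f)\in\mathbb{C}$ with $$f(z)=c_0^{\mathcal{R}}(f)+\sum_{\omega\in\mathcal{E}_\Lambda/\tau}\sum_{n\in\mathbb{Z}}\sum_{k\geq1}\frac{(-1)^{k-1}c_k(f,\alpha_\omega+ns)}{(k-1)!}\,\zeta_\Lambda^{(k-1)}(z-\alpha_\omega-ns),$$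 where $\zeta_\Lambda^{(j)}$ is the $j$-th derivative. Panorbital residues: $\mathrm{PanOres}^{\mathcal{R}}(f,0):=c_0^{\mathcal{R}}(f)$ and $\mathrm{PanOres}^{\mathcal{R}}(f,1):=\sum_{\omega\in\mathcal{E}_\Lambda/\tau}\sum_{n\in\mathbb{Z}}n\cdot c_1(f,\alpha_\omega+ns)$. *)

theory Defs
  imports "HOL-Complex_Analysis.Complex_Analysis"
begin

definition is_lattice :: "complex set \<Rightarrow> bool" where
  "is_lattice \<Lambda> \<longleftrightarrow> (\<exists>\<omega>1 \<omega>2.
     (\<forall>a b :: real. of_real a * \<omega>1 + of_real b * \<omega>2 = 0 \<longrightarrow> a = 0 \<and> b = 0) \<and>
     \<Lambda> = {of_int m * \<omega>1 + of_int n * \<omega>2 | m n :: int. True})"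

text \<open>
  A meromorphic function is represented by its unique \<^const>\<open>nicely_meromorphic_on\<close>
  representative (removable singularities filled in, value 0 at the poles), so that equality
  of elements of the field is equality of HOL functions; its field operations are the pointwise
  ones followed by \<^const>\<open>remove_sings\<close>.
\<close>

definition elliptic_field :: "complex set \<Rightarrow> (complex \<Rightarrow> complex) set" where
  "elliptic_field \<Lambda> =
     {f. f nicely_meromorphic_on UNIV \<and> (\<forall>z. \<forall>l\<in>\<Lambda>. f (z + l) = f z)}"

definition shift_op :: "complex \<Rightarrow> (complex \<Rightarrow> complex) \<Rightarrow> complex \<Rightarrow> complex" where
  "shift_op s f = (\<lambda>z. f (z + s))"

definition elliptically_summable :: "complex set \<Rightarrow> complex \<Rightarrow> (complex \<Rightarrow> complex) \<Rightarrow> bool" where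
  "elliptically_summable \<Lambda> s f \<longleftrightarrow>
     (\<exists>g\<in>elliptic_field \<Lambda>. f = remove_sings (\<lambda>z. shift_op s g z - g z))"

text \<open>Points of \<open>\<complex>/\<Lambda>\<close> are the cosets \<open>t + \<Lambda>\<close>; an orbit is a set of such points.\<close>

definition torus_point :: "complex set \<Rightarrow> complex \<Rightarrow> complex set" where
  "torus_point \<Lambda> t = (\<lambda>l. t + l) ` \<Lambda>"

definition tau_orbit :: "complex set \<Rightarrow> complex \<Rightarrow> complex \<Rightarrow> complex set set" where
  "tau_orbit \<Lambda> s t = range (\<lambda>n::int. torus_point \<Lambda> (t + of_int n * s))"

definition tau_orbits :: "complex set \<Rightarrow> complex \<Rightarrow> complex set set set" where
  "tau_orbits \<Lambda> s = range (tau_orbit \<Lambda> s)"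

text \<open>The image of \<open>s\<close> in \<open>\<complex>/\<Lambda>\<close> has infinite order.\<close>

definition non_torsion :: "complex set \<Rightarrow> complex \<Rightarrow> bool" where
  "non_torsion \<Lambda> s \<longleftrightarrow>
     (\<forall>n::int. n \<noteq> 0 \<longrightarrow> torus_point \<Lambda> (of_int n * s) \<noteq> torus_point \<Lambda> 0)"

definition tau_pinning ::
    "complex set \<Rightarrow> complex \<Rightarrow> (complex set set \<Rightarrow> complex) \<Rightarrow> bool" where
  "tau_pinning \<Lambda> s \<alpha> \<longleftrightarrow> (\<forall>\<omega>\<in>tau_orbits \<Lambda> s. torus_point \<Lambda> (\<alpha> \<omega>) \<in> \<omega>)"

text \<open>The coefficient \<open>c\<^sub>k(f,a)\<close> of \<open>(z - a)\<close> to the power \<open>-k\<close>.\<close>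

definition polar_coeff :: "nat \<Rightarrow> (complex \<Rightarrow> complex) \<Rightarrow> complex \<Rightarrow> complex" where
  "polar_coeff k f a = fls_nth (laurent_expansion f a) (- int k)"

text \<open>
  The same coefficient at a point of \<open>\<complex>/\<Lambda>\<close>; for functions in \<^const>\<open>elliptic_field\<close>
  it does not depend on the chosen representative.
\<close>

definition torus_polar_coeff :: "nat \<Rightarrow> (complex \<Rightarrow> complex) \<Rightarrow> complex set \<Rightarrow> complex" where
  "torus_polar_coeff k f p = polar_coeff k f (SOME a. a \<in> p)"

text \<open>
  The sums over orbits, over \<open>n\<close> and over \<open>k\<close> below have only finitely many
  nonzero terms when \<open>f\<close> is in \<^const>\<open>elliptic_field\<close> and \<open>s\<close> is non-torsion.
\<close>

definition Ores :: "(complex \<Rightarrow> complex) \<Rightarrow> complex set set \<Rightarrow> nat \<Rightarrow> complex" where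
  "Ores f \<omega> k = (\<Sum>\<^sub>\<infinity>p\<in>\<omega>. torus_polar_coeff k f p)"

definition weierstrass_zeta :: "complex set \<Rightarrow> complex \<Rightarrow> complex" where
  "weierstrass_zeta \<Lambda> z =
     1 / z + (\<Sum>\<^sub>\<infinity>l\<in>\<Lambda> - {0}. 1 / (z - l) + 1 / l + z / l ^ 2)"

definition zeta_part ::
    "complex set \<Rightarrow> complex \<Rightarrow> (complex set set \<Rightarrow> complex) \<Rightarrow> (complex \<Rightarrow> complex) \<Rightarrow> complex \<Rightarrow> complex"
  where
  "zeta_part \<Lambda> s \<alpha> f z =
     (\<Sum>\<^sub>\<infinity>\<omega>\<in>tau_orbits \<Lambda> s. \<Sum>\<^sub>\<infinity>n\<in>(UNIV :: int set). \<Sum>\<^sub>\<infinity>k\<in>{1..}.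
        (- 1) ^ (k - 1) * polar_coeff k f (\<alpha> \<omega> + of_int n * s) / fact (k - 1) *
        (deriv ^^ (k - 1)) (weierstrass_zeta \<Lambda>) (z - \<alpha> \<omega> - of_int n * s))"

text \<open>
  The zeta expansion is an identity of meromorphic functions, so it is required only off a
  sparse set: at the poles the HOL values of its two sides carry no information.
\<close>

definition c0 ::
    "complex set \<Rightarrow> complex \<Rightarrow> (complex set set \<Rightarrow> complex) \<Rightarrow> (complex \<Rightarrow> complex) \<Rightarrow> complex" where
  "c0 \<Lambda> s \<alpha> f = (THE c. \<forall>\<^sub>\<approx>z\<in>UNIV. f z = c + zeta_part \<Lambda> s \<alpha> f z)"

definition PanOres0 ::
    "complex set \<Rightarrow> complex \<Rightarrow> (complex set set \<Rightarrow> complex) \<Rightarrow> (complex \<Rightarrow> complex) \<Rightarrow> complex" where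
  "PanOres0 \<Lambda> s \<alpha> f = c0 \<Lambda> s \<alpha> f"

definition PanOres1 ::
    "complex set \<Rightarrow> complex \<Rightarrow> (complex set set \<Rightarrow> complex) \<Rightarrow> (complex \<Rightarrow> complex) \<Rightarrow> complex" where
  "PanOres1 \<Lambda> s \<alpha> f =
     (\<Sum>\<^sub>\<infinity>\<omega>\<in>tau_orbits \<Lambda> s. \<Sum>\<^sub>\<infinity>n\<in>(UNIV :: int set).
        of_int n * polar_coeff 1 f (\<alpha> \<omega> + of_int n * s))"

end

theory Submission
  imports Defs
begin

text \<open>
  With \<open>Z k = (- 1) ^ (k - 1) / (k - 1)! * zeta ^ (k - 1)\<close> (derivatives), an elliptic function
  is a constant plus a finite combination of translates of the \<open>Z k\<close>, and such a combination is
  elliptic exactly when the coefficients of the \<open>Z 1\<close> sum to zero. Hence \<open>tau g - g\<close> acts on the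
  coefficients along each orbit as a difference operator, and the constant of \<open>tau g - g\<close> is zero.
  A finitely supported sequence is the difference of a finitely supported one exactly when its
  sum vanishes (the orbital residues). The primitive so obtained defines an elliptic
  function exactly when its first-order coefficients sum to zero, and by summation by parts this
  sum is minus the first panorbital residue.
\<close>

section \<open>Lattices\<close>

text \<open>The fact behind the ellipticity criterion is that \<open>quasi_period\<close> is not the
  restriction to the lattice of a complex-linear map. Subtracting from an elliptic function the zeta
  combination with the same polar coefficients leaves a function without poles whose increment under
  a period \<open>a\<close> is \<open>- quasi_period a\<close> times the sum of the residues. Its
  derivative is periodic, hence constant, so the increments are \<open>A * a\<close> for a single
  \<open>A\<close>. Non-linearity then forces the residue sum to vanish, and after it
  \<open>A\<close>. One application of Liouville's theorem thus yields both the residue theorem and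
  the expansion.

  The other theme is that values at poles are conventions. Identities between meromorphic functions
  are mostly carried as \<open>eventually ... (at x)\<close> for every \<open>x\<close> and become
  equalities of functions through \<open>remove_sings\<close>. The infinite sums of the definitions
  collapse to a finite box of indices outside which all polar coefficients vanish. A function and
  its primitive share one such box, so the difference calculus deals with finite sums only.\<close>

locale complex_lattice =
  fixes L :: "complex set" and w1 w2 :: complex
  assumes indep: "\<And>a b :: real. of_real a * w1 + of_real b * w2 = 0 \<Longrightarrow> a = 0 \<and> b = 0"
    and L_eq: "L = {of_int m * w1 + of_int n * w2 | m n :: int. True}"

lemma is_latticeE:
  assumes "is_lattice L"
  obtains w1 w2 where "complex_lattice L w1 w2"
  using assms unfolding is_lattice_def complex_lattice_def by metis

context complex_lattice
begin

lemma latticeI: "of_int m * w1 + of_int n * w2 \<in> L"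
  unfolding L_eq by blast

lemma latticeE:
  assumes "l \<in> L"
  obtains m n :: int where "l = of_int m * w1 + of_int n * w2"
  using assms unfolding L_eq by blast

lemma zero_in_lattice [simp]: "0 \<in> L"
  using latticeI[of 0 0] by simp

lemma w1_in_lattice [simp]: "w1 \<in> L"
  using latticeI[of 1 0] by simp

lemma w2_in_lattice [simp]: "w2 \<in> L"
  using latticeI[of 0 1] by simp

lemma lattice_add: "a \<in> L \<Longrightarrow> b \<in> L \<Longrightarrow> a + b \<in> L"
proof (elim latticeE)
  fix m n m' n' :: int
  assume "a = of_int m * w1 + of_int n * w2" "b = of_int m' * w1 + of_int n' * w2"
  then show "a + b \<in> L"
    using latticeI[of "m + m'" "n + n'"] by (simp add: algebra_simps)
qed

lemma lattice_uminus: "a \<in> L \<Longrightarrow> - a \<in> L"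
proof (elim latticeE)
  fix m n :: int
  assume "a = of_int m * w1 + of_int n * w2"
  then show "- a \<in> L"
    using latticeI[of "- m" "- n"] by simp
qed

lemma lattice_diff: "a \<in> L \<Longrightarrow> b \<in> L \<Longrightarrow> a - b \<in> L"
  using lattice_add[of a "- b"] lattice_uminus[of b] by simp

lemma lattice_uminus_iff [simp]: "- a \<in> L \<longleftrightarrow> a \<in> L"
  using lattice_uminus[of a] lattice_uminus[of "- a"] by auto

lemma lattice_add_iff: "a \<in> L \<Longrightarrow> z + a \<in> L \<longleftrightarrow> z \<in> L"
  using lattice_add[of z a] lattice_diff[of "z + a" a] by auto

text \<open>This is the signed area of the period parallelogram. If it vanishes,
  \<open>cnj w1 * w2\<close> is a real \<open>r\<close>, and multiplying by \<open>w1\<close> gives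
  a real relation between the periods in which \<open>w2\<close> has the coefficient |w1|^2.\<close>

lemma period_area_nz: "Im (cnj w1 * w2) \<noteq> 0"
proof
  assume Im: "Im (cnj w1 * w2) = 0"
  define r where "r = Re (cnj w1 * w2)"
  have r: "cnj w1 * w2 = of_real r"
    using Im by (simp add: r_def complex_eq_iff)
  have "of_real (- r) * w1 + of_real ((cmod w1)\<^sup>2) * w2 = 0"
    unfolding complex_norm_square using r by (simp add: algebra_simps flip: r)
  then have "(cmod w1)\<^sup>2 = 0"
    using indep by blast
  then have "w1 = 0" by simp
  then show False
    using indep[of 1 0] by simp
qed

lemma real_coordinates:
  obtains x y :: real where "z = of_real x * w1 + of_real y * w2"
proof -
  define D where "D = Im (cnj w1 * w2)"
  have D: "D \<noteq> 0"
    using period_area_nz by (simp add: D_def)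
  obtain X Y :: real where "of_real D * z = of_real X * w1 + of_real Y * w2"
  proof
    \<comment> \<open>Cramer's rule: \<open>Im (cnj a * b)\<close> is alternating and real-bilinear,
      so pairing \<open>z\<close> with one period isolates the coordinate along the other.\<close>
    show "of_real D * z = of_real (- Im (cnj w2 * z)) * w1 + of_real (Im (cnj w1 * z)) * w2"
      by (simp add: complex_eq_iff D_def algebra_simps)
  qed
  then have "z = of_real (X / D) * w1 + of_real (Y / D) * w2"
    using D by (simp add: field_simps)
  then show ?thesis
    using that by blast
qed

text \<open>Cramer's rule with absolute values: a coordinate times the area is a pairing of the
  point with a period, bounded by the product of their norms. This yields both the discreteness of
  the lattice and the convergence of its sums.\<close>

lemma coordinate_bound:
  obtains c where "c > 0" "\<And>x y :: real. max \<bar>x\<bar> \<bar>y\<bar> \<le> c * cmod (of_real x * w1 + of_real y * w2)"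
proof
  define D where "D = \<bar>Im (cnj w1 * w2)\<bar>"
  define N where "N = cmod w1 + cmod w2"
  have D: "D > 0"
    using period_area_nz by (simp add: D_def)
  have "w1 \<noteq> 0"
    using indep[of 1 0] by auto
  then have N: "N > 0"
    unfolding N_def by (simp add: add_pos_nonneg)
  show "N / D > 0"
    using D N by simp
  fix x y :: real
  let ?z = "of_real x * w1 + of_real y * w2"
  have "Im (cnj w1 * ?z) = y * Im (cnj w1 * w2)" "Im (cnj w2 * ?z) = - x * Im (cnj w1 * w2)"
    by (simp_all add: algebra_simps)
  then have "\<bar>y\<bar> * D = \<bar>Im (cnj w1 * ?z)\<bar>" "\<bar>x\<bar> * D = \<bar>Im (cnj w2 * ?z)\<bar>"
    by (simp_all add: D_def abs_mult)
  then have "\<bar>y\<bar> * D \<le> cmod (cnj w1 * ?z)" "\<bar>x\<bar> * D \<le> cmod (cnj w2 * ?z)"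
    by (metis abs_Im_le_cmod)+
  then have "\<bar>y\<bar> * D \<le> N * cmod ?z" "\<bar>x\<bar> * D \<le> N * cmod ?z"
    unfolding norm_mult N_def complex_mod_cnj by (auto simp: distrib_right intro: order_trans)
  then show "max \<bar>x\<bar> \<bar>y\<bar> \<le> N / D * cmod ?z"
    using D by (simp add: field_simps)
qed

lemma finite_lattice_cball: "finite {l \<in> L. cmod l \<le> R}"
proof -
  obtain c where c: "c > 0" "\<And>x y :: real. max \<bar>x\<bar> \<bar>y\<bar> \<le> c * cmod (of_real x * w1 + of_real y * w2)"
    using coordinate_bound by metis
  define B where "B = {- \<lceil>c * R\<rceil> .. \<lceil>c * R\<rceil>}"
  have "{l \<in> L. cmod l \<le> R} \<subseteq> (\<lambda>(m, n). of_int m * w1 + of_int n * w2) ` (B \<times> B)"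
  proof safe
    fix l assume "l \<in> L" and le: "cmod l \<le> R"
    then obtain m n :: int where l: "l = of_int m * w1 + of_int n * w2"
      by (auto elim: latticeE)
    have "max \<bar>of_int m :: real\<bar> \<bar>of_int n\<bar> \<le> c * R"
      using c(2)[of "of_int m" "of_int n"] l le c(1)
      by (auto intro: order_trans mult_left_mono)
    then have "m \<in> B" "n \<in> B"
      unfolding B_def by (auto simp: abs_le_iff ceiling_le_iff le_ceiling_iff) linarith+
    then show "l \<in> (\<lambda>(m, n). of_int m * w1 + of_int n * w2) ` (B \<times> B)"
      using l by auto
  qed
  then show ?thesis
    by (rule finite_subset) (auto simp: B_def)
qed

lemma eventually_not_in_lattice: "eventually (\<lambda>z. z \<notin> L) (at a)"
proof -
  define F where "F = {l \<in> L. cmod l \<le> cmod a + 1}"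
  have "\<not> a islimpt F"
    unfolding F_def by (intro islimpt_finite finite_lattice_cball)
  then have "eventually (\<lambda>z. z \<notin> F) (at a)"
    by (simp add: islimpt_iff_eventually)
  moreover have "eventually (\<lambda>z. z \<in> ball a 1) (at a)"
    by (rule eventually_at_in_open') auto
  ultimately show ?thesis
  proof eventually_elim
    case (elim z)
    have "cmod z \<le> cmod a + 1"
      using elim(2) norm_triangle_sub[of z a] by (simp add: dist_norm norm_minus_commute)
    then show ?case
      using elim(1) by (auto simp: F_def)
  qed
qed

lemma eventually_diff_not_in_lattice: "eventually (\<lambda>z. z - b \<notin> L) (at a)"
proof -
  have "eventually (\<lambda>z. z \<notin> L) (at (a - b))"
    by (rule eventually_not_in_lattice)
  then show ?thesis
    by (simp add: at_to_0' eventually_filtermap algebra_simps)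
qed

lemma closed_lattice: "closed L"
  unfolding closed_limpt islimpt_iff_eventually using eventually_not_in_lattice by blast

text \<open>Subtracting the integer parts of the real coordinates leaves fractional parts. The disc
  stands in for a period parallelogram: it bounds periodic functions and confines the poles modulo
  the lattice.\<close>

lemma translate_into_compact:
  obtains l where "l \<in> L" "z + l \<in> cball 0 (cmod w1 + cmod w2)"
proof -
  obtain x y :: real where z: "z = of_real x * w1 + of_real y * w2"
    using real_coordinates .
  define l where "l = of_int (- \<lfloor>x\<rfloor>) * w1 + of_int (- \<lfloor>y\<rfloor>) * w2"
  have "z + l = of_real (frac x) * w1 + of_real (frac y) * w2"
    by (simp add: z l_def frac_def algebra_simps)
  then have "cmod (z + l) \<le> frac x * cmod w1 + frac y * cmod w2"
    using norm_triangle_ineq[of "of_real (frac x) * w1" "of_real (frac y) * w2"]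
    by (simp add: norm_mult)
  also have "\<dots> \<le> 1 * cmod w1 + 1 * cmod w2"
    by (intro add_mono mult_right_mono) (auto simp: frac_lt_1 less_imp_le)
  finally show ?thesis
    using that[of l] latticeI[of "- \<lfloor>x\<rfloor>" "- \<lfloor>y\<rfloor>"] by (simp add: l_def)
qed

text \<open>One parity argument covers all three: if \<open>a * w1 / 2 + b * w2 / 2\<close> lies in
  the lattice, independence makes \<open>a\<close> and \<open>b\<close> even.\<close>

lemma half_period_not_in_lattice:
  "w1 / 2 \<notin> L" "w2 / 2 \<notin> L" "(w1 + w2) / 2 \<notin> L"
proof -
  have *: False if h: "of_int a * w1 / 2 + of_int b * w2 / 2 \<in> L" and odd: "odd a \<or> odd b" for a b :: int
  proof -
    obtain m n :: int where mn: "of_int a * w1 / 2 + of_int b * w2 / 2 = of_int m * w1 + of_int n * w2"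
      using h by (rule latticeE)
    have "of_real (of_int (a - 2 * m)) * w1 + of_real (of_int (b - 2 * n)) * w2 = 0"
      using mn by (simp add: field_simps)
    then have "a - 2 * m = 0 \<and> b - 2 * n = 0"
      using indep by (metis of_int_eq_0_iff)
    then show False
      using odd by presburger
  qed
  show "w1 / 2 \<notin> L" using *[of 1 0] by auto
  show "w2 / 2 \<notin> L" using *[of 0 1] by auto
  show "(w1 + w2) / 2 \<notin> L" using *[of 1 1] by (auto simp: add_divide_distrib)
qed

text \<open>The sum is dominated by a product of two one-dimensional sums. The exponent 3/2 is half
  of the required 3 and still above 1, so each factor converges.\<close>

lemma summable_inverse_cube: "(\<lambda>l. 1 / cmod l ^ 3) summable_on L"
proof -
  define p :: "int \<Rightarrow> real" where "p = (\<lambda>m. (1 + \<bar>of_int m\<bar>) powr (- (3 / 2)))"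
  have "summable (\<lambda>n. 1 / real n powr (3 / 2))"
    using summable_real_powr_iff[of "- (3/2)"] by (simp add: powr_minus_divide)
  then have "summable (\<lambda>n. (1 + real n) powr (- (3 / 2)))"
    by (subst (asm) summable_Suc_iff[symmetric]) (simp add: powr_minus_divide add.commute)
  then have nat: "(\<lambda>n. (1 + real n) powr (- (3 / 2))) summable_on UNIV"
    by (subst summable_on_UNIV_nonneg_real_iff) auto
  have "p summable_on range int"
    by (subst summable_on_reindex) (use nat in \<open>auto simp: p_def o_def\<close>)
  moreover have "p summable_on range (\<lambda>n. - int n)"
    by (subst summable_on_reindex) (use nat in \<open>auto simp: p_def o_def inj_on_def\<close>)
  moreover have "range int \<union> range (\<lambda>n. - int n) = UNIV"
    by (auto simp: image_def) (metis int_cases2)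
  ultimately have p: "p summable_on UNIV"
    using summable_on_union by metis
  have "(\<lambda>(m, n). p m * p n) summable_on (UNIV \<times> UNIV)"
  proof (rule summable_on_SigmaI)
    show "((\<lambda>n. case (m, n) of (m, n) \<Rightarrow> p m * p n) has_sum (p m * infsum p UNIV)) UNIV" for m
      using p by (auto intro!: has_sum_cmult_right)
    show "(\<lambda>m. p m * infsum p UNIV) summable_on UNIV"
      using p by (rule summable_on_cmult_left)
  qed (auto simp: p_def)
  then have pp: "(\<lambda>(m, n). p m * p n) summable_on UNIV"
    by simp
  obtain c where c: "c > 0" "\<And>x y :: real. max \<bar>x\<bar> \<bar>y\<bar> \<le> c * cmod (of_real x * w1 + of_real y * w2)"
    using coordinate_bound by metis
  define h :: "int \<times> int \<Rightarrow> complex" where "h = (\<lambda>(m, n). of_int m * w1 + of_int n * w2)"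
  have inj: "inj h"
  proof (rule injI, clarify)
    fix m n m' n' :: int
    assume "h (m, n) = h (m', n')"
    then have "of_real (of_int (m - m')) * w1 + of_real (of_int (n - n')) * w2 = 0"
      by (simp add: h_def algebra_simps)
    then have "m - m' = 0 \<and> n - n' = 0"
      using indep by (metis of_int_eq_0_iff)
    then show "m = m' \<and> n = n'" by simp
  qed
  have range: "L = range h"
    unfolding L_eq h_def by auto
  have "(\<lambda>x. 1 / cmod (h x) ^ 3) summable_on UNIV"
  proof (rule summable_on_comparison_test)
    \<comment> \<open>With \<open>M\<close> the larger absolute coordinate, \<open>c ^ 3\<close>
      comes from \<open>M \<le> c * cmod (h x)\<close>, and 8 from bounding both factors
      \<open>1 + |m|\<close> and \<open>1 + |n|\<close> by \<open>2 * M\<close>.\<close>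
    show "(\<lambda>x. (8 * c ^ 3) * (case x of (m, n) \<Rightarrow> p m * p n)) summable_on UNIV"
      using pp by (rule summable_on_cmult_right)
    fix x :: "int \<times> int"
    obtain m n where x: "x = (m, n)" by force
    define M where "M = max \<bar>real_of_int m\<bar> \<bar>real_of_int n\<bar>"
    show "1 / cmod (h x) ^ 3 \<le> (8 * c ^ 3) * (case x of (m, n) \<Rightarrow> p m * p n)"
    proof (cases "M = 0")
      \<comment> \<open>This is the lattice point 0, whose term is 0 because
        \<open>1 / 0 = 0\<close>.\<close>
      case True
      then have "m = 0" "n = 0" by (auto simp: M_def)
      then show ?thesis
        using c(1) by (simp add: x h_def p_def)
    next
      case False
      then have M1: "M \<ge> 1"
        unfolding M_def by (cases "m = 0"; cases "n = 0") (auto simp: max_def)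
      have "M \<le> c * cmod (h x)"
        using c(2)[of "of_int m" "of_int n"] by (simp add: x h_def M_def)
      then have "M ^ 3 \<le> (c * cmod (h x)) ^ 3"
        using M1 by (intro power_mono) auto
      then have "M ^ 3 \<le> c ^ 3 * cmod (h x) ^ 3"
        by (simp add: power_mult_distrib)
      moreover have M3: "M ^ 3 > 0" using M1 by simp
      moreover from calculation have "cmod (h x) > 0"
        by (cases "h x = 0") auto
      ultimately have 1: "1 / cmod (h x) ^ 3 \<le> c ^ 3 / M ^ 3"
        by (simp add: field_simps)
      have "(1 + \<bar>of_int m\<bar>) * (1 + \<bar>of_int n\<bar>) \<le> (2 * M) * (2 * M)"
        using M1 by (intro mult_mono) (auto simp: M_def)
      then have "((1 + \<bar>of_int m\<bar>) * (1 + \<bar>of_int n\<bar>)) powr (3 / 2) \<le> ((2 * M) * (2 * M)) powr (3 / 2)"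
        by (intro powr_mono2) auto
      also have "\<dots> = (2 * M) powr 3"
        using M1 by (simp add: powr_mult flip: powr_add)
      also have "\<dots> = 8 * M ^ 3"
        using M1 by (simp add: powr_numeral power_mult_distrib)
      finally have 2: "((1 + \<bar>of_int m\<bar>) * (1 + \<bar>of_int n\<bar>)) powr (3 / 2) \<le> 8 * M ^ 3" .
      have "1 / (8 * M ^ 3) \<le> 1 / ((1 + \<bar>of_int m\<bar>) * (1 + \<bar>of_int n\<bar>)) powr (3 / 2)"
        using 2 M1 by (intro divide_left_mono) (auto intro!: mult_pos_pos)
      also have "\<dots> = p m * p n"
        by (simp add: p_def powr_minus_divide powr_mult)
      finally have "8 * c ^ 3 * (1 / (8 * M ^ 3)) \<le> 8 * c ^ 3 * (p m * p n)"
        using c(1) by (intro mult_left_mono) auto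
      then show ?thesis
        using 1 by (simp add: x)
    qed
  qed auto
  then show ?thesis
    unfolding range using inj by (subst summable_on_reindex) (auto simp: o_def)
qed

end

section \<open>The Weierstrass zeta function\<close>

context complex_lattice
begin

abbreviation zeta :: "complex \<Rightarrow> complex" where
  "zeta \<equiv> weierstrass_zeta L"

definition zeta_term :: "complex \<Rightarrow> complex \<Rightarrow> complex" where
  "zeta_term l z = 1 / (z - l) + 1 / l + z / l ^ 2"

text \<open>The correction terms cancel the first two terms of the expansion of
  \<open>1 / (z - l)\<close> in powers of \<open>z\<close>, leaving
  \<open>z^2 / (l^2 * (z - l))\<close>. The factor 2 comes from
  \<open>cmod l / 2 \<le> cmod (z - l)\<close>.\<close>

lemma norm_zeta_term_le:
  assumes "cmod z \<le> R" "2 * R < cmod l"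
  shows "cmod (zeta_term l z) \<le> 2 * R\<^sup>2 * (1 / cmod l ^ 3)"
proof -
  have R: "0 \<le> R"
    using assms(1) norm_ge_zero order_trans by blast
  have l: "cmod l > 0"
    using assms(2) R by linarith
  have half: "cmod l / 2 \<le> cmod (z - l)"
    using assms norm_triangle_ineq2[of l z] by (simp add: norm_minus_commute)
  then have "z - l \<noteq> 0" "l \<noteq> 0"
    using l by auto
  then have "zeta_term l z = z\<^sup>2 / (l\<^sup>2 * (z - l))"
    by (simp add: zeta_term_def field_simps power2_eq_square)
  then have "cmod (zeta_term l z) = (cmod z)\<^sup>2 / ((cmod l)\<^sup>2 * cmod (z - l))"
    by (simp add: norm_divide norm_mult norm_power)
  also have "\<dots> \<le> R\<^sup>2 / ((cmod l)\<^sup>2 * (cmod l / 2))"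
    using half l assms by (intro frac_le power_mono mult_left_mono) auto
  also have "\<dots> = 2 * R\<^sup>2 * (1 / cmod l ^ 3)"
    by (simp add: power2_eq_square power3_eq_cube)
  finally show ?thesis .
qed

lemma summable_zeta_bound: "A \<subseteq> L \<Longrightarrow> (\<lambda>l. c * (1 / cmod l ^ 3)) summable_on A"
  using summable_inverse_cube summable_on_cmult_right summable_on_subset_banach by metis

text \<open>Only finitely many lattice points escape the cubic bound. This includes \<open>z\<close>
  in the lattice, where the singular fraction has the value 0.\<close>

lemma zeta_term_summable: "(\<lambda>l. zeta_term l z) summable_on L"
proof -
  define F where "F = {l \<in> L. cmod l \<le> 2 * cmod z}"
  have "(\<lambda>l. zeta_term l z) summable_on (L - F)"
  proof (rule abs_summable_summable, rule Infinite_Sum.abs_summable_on_comparison_test')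
    show "(\<lambda>l. 2 * (cmod z)\<^sup>2 * (1 / cmod l ^ 3)) summable_on (L - F)"
      by (rule summable_zeta_bound) blast
    show "cmod (zeta_term l z) \<le> 2 * (cmod z)\<^sup>2 * (1 / cmod l ^ 3)" if "l \<in> L - F" for l
      using that by (intro norm_zeta_term_le) (auto simp: F_def)
  qed
  moreover have "(\<lambda>l. zeta_term l z) summable_on F"
    unfolding F_def by (intro summable_on_finite finite_lattice_cball)
  moreover have "L = (L - F) \<union> F"
    by (auto simp: F_def)
  ultimately show ?thesis
    using summable_on_union by metis
qed

text \<open>
  The term of the zeta series at \<open>l = 0\<close> is \<open>1 / z\<close>, since \<open>1 / 0 = 0\<close>.
\<close>

lemma zeta_has_sum: "((\<lambda>l. zeta_term l z) has_sum zeta z) L"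
proof -
  have "(\<lambda>l. zeta_term l z) summable_on (L - {0})"
    using zeta_term_summable summable_on_subset_banach Diff_subset by metis
  then have "((\<lambda>l. zeta_term l z) has_sum (\<Sum>\<^sub>\<infinity>l\<in>L - {0}. zeta_term l z)) (L - {0})"
    by simp
  then have "((\<lambda>l. zeta_term l z) has_sum (zeta_term 0 z + (\<Sum>\<^sub>\<infinity>l\<in>L - {0}. zeta_term l z)))
     (insert 0 (L - {0}))"
    by (rule has_sum_insert[rotated]) auto
  moreover have "zeta_term 0 z + (\<Sum>\<^sub>\<infinity>l\<in>L - {0}. zeta_term l z) = zeta z"
    by (simp add: weierstrass_zeta_def zeta_term_def)
  ultimately show ?thesis
    by (simp add: insert_absorb)
qed

text \<open>The radius \<open>2 * R\<close> is dictated by \<open>norm_zeta_term_le\<close>: beyond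
  it the terms have no poles in the ball and the M-test applies, so the tail is a uniform limit of
  holomorphic functions.\<close>

lemma zeta_ball_decomposition:
  assumes "R > 0"
  obtains h where "h holomorphic_on ball 0 R"
    "\<And>z. z \<in> ball 0 R \<Longrightarrow> zeta z = (\<Sum>l | l \<in> L \<and> cmod l \<le> 2 * R. zeta_term l z) + h z"
proof -
  define F where "F = {l \<in> L. cmod l \<le> 2 * R}"
  have fin: "finite F"
    unfolding F_def by (rule finite_lattice_cball)
  define h where "h = (\<lambda>z. \<Sum>\<^sub>\<infinity>l\<in>L - F. zeta_term l z)"
  have "uniform_limit (cball 0 R) (\<lambda>X z. \<Sum>l\<in>X. zeta_term l z) h (finite_subsets_at_top (L - F))"
    unfolding h_def
  proof (rule Weierstrass_m_test_general)
    show "cmod (zeta_term l z) \<le> 2 * R\<^sup>2 * (1 / cmod l ^ 3)" if "l \<in> L - F" "z \<in> cball 0 R" for l z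
      using that by (intro norm_zeta_term_le) (auto simp: F_def)
  qed (rule summable_zeta_bound, blast)
  moreover have "eventually (\<lambda>X. continuous_on (cball 0 R) (\<lambda>z. \<Sum>l\<in>X. zeta_term l z) \<and>
      (\<lambda>z. \<Sum>l\<in>X. zeta_term l z) holomorphic_on ball 0 R) (finite_subsets_at_top (L - F))"
  proof (rule eventually_finite_subsets_at_top_weakI)
    fix X assume "X \<subseteq> L - F"
    then have "z \<noteq> l" if "l \<in> X" "z \<in> cball 0 R" for l z
      using that assms by (auto simp: F_def)
    then have "(\<lambda>z. \<Sum>l\<in>X. zeta_term l z) holomorphic_on cball 0 R"
      unfolding zeta_term_def by (auto intro!: holomorphic_intros simp: divide_inverse)
    then show "continuous_on (cball 0 R) (\<lambda>z. \<Sum>l\<in>X. zeta_term l z) \<and>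
      (\<lambda>z. \<Sum>l\<in>X. zeta_term l z) holomorphic_on ball 0 R"
      by (meson ball_subset_cball holomorphic_on_imp_continuous_on holomorphic_on_subset)
  qed
  ultimately have "h holomorphic_on ball 0 R"
    using holomorphic_uniform_limit[of 0 R "\<lambda>X z. \<Sum>l\<in>X. zeta_term l z" "finite_subsets_at_top (L - F)" h]
    by (auto simp: finite_subsets_at_top_neq_bot)
  moreover have "zeta z = (\<Sum>l\<in>F. zeta_term l z) + h z" for z
  proof -
    have "((\<lambda>l. zeta_term l z) has_sum h z) (L - F)"
      unfolding h_def using zeta_term_summable summable_on_subset_banach
      by (metis Diff_subset has_sum_infsum)
    moreover have "((\<lambda>l. zeta_term l z) has_sum (\<Sum>l\<in>F. zeta_term l z)) F"
      using fin by (rule has_sum_finite)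
    ultimately have "((\<lambda>l. zeta_term l z) has_sum ((\<Sum>l\<in>F. zeta_term l z) + h z)) (F \<union> (L - F))"
      by (intro has_sum_Un_disjoint) auto
    moreover have "F \<union> (L - F) = L"
      by (auto simp: F_def)
    ultimately show ?thesis
      using zeta_has_sum has_sum_unique by metis
  qed
  ultimately show ?thesis
    using that unfolding F_def by blast
qed

text \<open>In a ball around 0 containing \<open>a\<close>, only the term with \<open>l = a\<close>
  can be singular at \<open>a\<close>. The equation holds on a full neighbourhood, including
  \<open>a\<close> itself where \<open>1 / 0 = 0\<close>, so off the lattice it gives analyticity
  directly.\<close>

lemma zeta_minus_principal_part_analytic:
  "\<exists>h. h analytic_on {a} \<and> eventually (\<lambda>z. zeta z = (if a \<in> L then 1 / (z - a) else 0) + h z) (nhds a)"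
proof -
  define R where "R = cmod a + 1"
  have "R > 0"
    by (simp add: R_def add_nonneg_pos)
  then obtain h where h: "h holomorphic_on ball 0 R"
    "\<And>z. z \<in> ball 0 R \<Longrightarrow> zeta z = (\<Sum>l | l \<in> L \<and> cmod l \<le> 2 * R. zeta_term l z) + h z"
    using zeta_ball_decomposition by blast
  define F where "F = {l \<in> L. cmod l \<le> 2 * R}"
  have fin: "finite F"
    unfolding F_def by (rule finite_lattice_cball)
  have aR: "a \<in> ball 0 R"
    by (simp add: R_def)
  have h_an: "h analytic_on {a}"
    using h(1) aR open_ball unfolding analytic_at by blast
  have an: "zeta_term l analytic_on {a}" if "l \<noteq> a" for l
    unfolding zeta_term_def using that by (auto intro!: analytic_intros simp: divide_inverse)
  have ev: "eventually (\<lambda>z. z \<in> ball 0 R) (nhds a)"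
    by (rule eventually_nhds_in_open) (use aR in auto)
  show ?thesis
  proof (cases "a \<in> L")
    case True
    then have aF: "a \<in> F"
      using \<open>R > 0\<close> by (simp add: F_def R_def)
    \<comment> \<open>Only the pole of the term with \<open>l = a\<close> is split off; its
      convergence terms stay in \<open>g\<close>.\<close>
    define g where "g = (\<lambda>z. 1 / a + z / a ^ 2 + (\<Sum>l\<in>F - {a}. zeta_term l z) + h z)"
    have "(\<lambda>z. z / a ^ 2) analytic_on {a}"
      by (auto intro!: analytic_intros simp: divide_inverse)
    then have "g analytic_on {a}"
      unfolding g_def using an h_an by (intro analytic_on_add analytic_on_sum) auto
    moreover have "eventually (\<lambda>z. zeta z = 1 / (z - a) + g z) (nhds a)"
      using ev
    proof eventually_elim
      case (elim z)
      have "(\<Sum>l\<in>F. zeta_term l z) = zeta_term a z + (\<Sum>l\<in>F - {a}. zeta_term l z)"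
        using fin aF by (rule sum.remove)
      then show ?case
        using h(2)[OF elim] by (simp add: F_def g_def zeta_term_def)
    qed
    ultimately show ?thesis
      using True by auto
  next
    case False
    define g where "g = (\<lambda>z. (\<Sum>l\<in>F. zeta_term l z) + h z)"
    have "g analytic_on {a}"
      unfolding g_def by (intro analytic_on_add analytic_on_sum an h_an) (use False in \<open>auto simp: F_def\<close>)
    moreover have "eventually (\<lambda>z. zeta z = g z) (nhds a)"
      using ev by eventually_elim (use h(2) in \<open>auto simp: F_def g_def\<close>)
    ultimately show ?thesis
      using False by auto
  qed
qed

lemma zeta_analytic: "a \<notin> L \<Longrightarrow> zeta analytic_on {a}"
  using zeta_minus_principal_part_analytic[of a] analytic_at_cong[of zeta _ a a] by auto

text \<open>The lattice is invariant under \<open>l -> -l\<close>, and this reindexing changes the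
  sign of the summands evaluated at \<open>- z\<close>.\<close>

lemma zeta_odd: "zeta (- z) = - zeta z"
proof -
  have "((\<lambda>l. zeta_term l (- z)) has_sum - zeta z) L \<longleftrightarrow> ((\<lambda>l. - zeta_term l z) has_sum - zeta z) L"
  proof (rule has_sum_reindex_bij_witness[of _ uminus uminus])
    fix l assume "l \<in> L"
    show "- zeta_term (- l) z = zeta_term l (- z)"
    proof -
      have "1 / (z + l) = - (1 / (- z - l))"
        by (metis add.inverse_inverse minus_add_distrib minus_divide_right uminus_add_conv_diff add.commute)
      then show ?thesis
        by (simp add: zeta_term_def)
    qed
  qed auto
  moreover have "((\<lambda>l. - zeta_term l z) has_sum - zeta z) L"
    using zeta_has_sum by (simp add: has_sum_uminus)
  ultimately show ?thesis
    using zeta_has_sum[of "- z"] has_sum_unique by blast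
qed

text \<open>
  The second divided difference of the zeta series removes the convergence terms and leaves a sum
  over the lattice that is visibly translation invariant.
\<close>

lemma zeta_second_difference:
  assumes "z \<notin> L" "w \<notin> L" "u \<notin> L" "z \<noteq> w" "z \<noteq> u" "w \<noteq> u"
  shows "((\<lambda>l. 1 / ((z - l) * (w - l) * (u - l))) has_sum
     (zeta z / ((z - w) * (z - u)) + zeta w / ((w - z) * (w - u)) + zeta u / ((u - z) * (u - w)))) L"
    (is "(_ has_sum ?S) L")
proof -
  have sum: "((\<lambda>l. zeta_term l z / ((z - w) * (z - u)) + zeta_term l w / ((w - z) * (w - u)) +
     zeta_term l u / ((u - z) * (u - w))) has_sum ?S) L"
    by (simp only: divide_inverse) (intro has_sum_add has_sum_cmult_left zeta_has_sum)
  have eq: "zeta_term l z / ((z - w) * (z - u)) + zeta_term l w / ((w - z) * (w - u)) +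
     zeta_term l u / ((u - z) * (u - w)) = 1 / ((z - l) * (w - l) * (u - l))" if "l \<in> L" for l
  proof -
    \<comment> \<open>The convergence terms are affine in the variable, and second divided
      differences annihilate affine functions. With \<open>p\<close> and \<open>q\<close> named,
      \<open>l = 0\<close>, where both are 0, is no separate case.\<close>
    define p q where "p = 1 / l" and "q = 1 / l\<^sup>2"
    have nz: "z - w \<noteq> 0" "z - u \<noteq> 0" "w - u \<noteq> 0" "w - z \<noteq> 0" "u - z \<noteq> 0" "u - w \<noteq> 0"
      "z - l \<noteq> 0" "w - l \<noteq> 0" "u - l \<noteq> 0"
      using assms that by auto
    have affine: "(p + z * q) / ((z - w) * (z - u)) + (p + w * q) / ((w - z) * (w - u)) +
      (p + u * q) / ((u - z) * (u - w)) = 0"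
      using nz by (simp add: divide_simps) (simp add: algebra_simps)
    have pole: "1 / (z - l) / ((z - w) * (z - u)) + 1 / (w - l) / ((w - z) * (w - u)) +
      1 / (u - l) / ((u - z) * (u - w)) = 1 / ((z - l) * (w - l) * (u - l))"
      using nz by (simp add: divide_simps) (simp add: algebra_simps)
    have "zeta_term l x = 1 / (x - l) + (p + x * q)" for x
      by (simp add: zeta_term_def p_def q_def)
    then show ?thesis
      using affine pole by (simp add: add_divide_distrib algebra_simps)
  qed
  show ?thesis
    using sum by (simp only: eq cong: has_sum_cong)
qed

text \<open>Translating all three points by \<open>a\<close> only reindexes the lattice sum and
  leaves the denominators unchanged. Vanishing second divided differences are the form in which
  \<open>D\<close> is recognised as affine.\<close>

lemma zeta_second_difference_periodic:
  assumes "z \<notin> L" "w \<notin> L" "u \<notin> L" "z \<noteq> w" "z \<noteq> u" "w \<noteq> u" "a \<in> L"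
  defines "D \<equiv> \<lambda>z. zeta (z + a) - zeta z"
  shows "D z / ((z - w) * (z - u)) + D w / ((w - z) * (w - u)) + D u / ((u - z) * (u - w)) = 0"
proof -
  let ?f = "\<lambda>l. 1 / ((z - l) * (w - l) * (u - l))"
  let ?S = "\<lambda>z w u. zeta z / ((z - w) * (z - u)) + zeta w / ((w - z) * (w - u)) + zeta u / ((u - z) * (u - w))"
  have 1: "(?f has_sum ?S z w u) L"
    using assms by (intro zeta_second_difference) auto
  have "((\<lambda>l. 1 / ((z + a - l) * (w + a - l) * (u + a - l))) has_sum ?S (z + a) (w + a) (u + a)) L"
    using assms by (intro zeta_second_difference) (auto simp: lattice_add_iff)
  also have "?this \<longleftrightarrow> (?f has_sum ?S (z + a) (w + a) (u + a)) L"
    by (rule has_sum_reindex_bij_witness[of _ "\<lambda>l. l + a" "\<lambda>l. l - a"])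
       (use assms in \<open>auto simp: lattice_add lattice_diff algebra_simps\<close>)
  finally have "?S (z + a) (w + a) (u + a) = ?S z w u"
    using 1 has_sum_unique by blast
  then have "?S (z + a) (w + a) (u + a) = ?S z w u"
    by simp
  moreover have "x - x' + (y - y') + (v - v') = 0" if "x + y + v = x' + y' + v'" for x x' y y' v v' :: complex
    using that by (simp add: algebra_simps)
  ultimately show ?thesis
    by (simp add: D_def diff_divide_distrib)
qed

end

section \<open>Polar coefficients and quasi-periods\<close>

lemma polar_coeff_eqI:
  "(\<lambda>x. f (a + x)) has_laurent_expansion F \<Longrightarrow> polar_coeff k f a = fls_nth F (- int k)"
  by (simp add: polar_coeff_def laurent_expansion_eqI)

lemma polar_coeff_cong:
  "eventually (\<lambda>z. f z = g z) (at a) \<Longrightarrow> polar_coeff k f a = polar_coeff k g a"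
  by (simp add: polar_coeff_def laurent_expansion_cong)

lemma meromorphic_has_laurent_expansion:
  "f meromorphic_on UNIV \<Longrightarrow> (\<lambda>x. f (a + x)) has_laurent_expansion laurent_expansion f a"
  by (rule meromorphic_on_imp_has_laurent_expansion) auto

lemma meromorphic_on_translate:
  "f meromorphic_on UNIV \<Longrightarrow> (\<lambda>z. f (z + c)) meromorphic_on UNIV"
  by (rule meromorphic_on_compose[where f = "\<lambda>z. z + c"]) (auto intro!: analytic_intros)

lemma polar_coeff_diff:
  assumes "f meromorphic_on UNIV" "g meromorphic_on UNIV"
  shows "polar_coeff k (\<lambda>z. f z - g z) a = polar_coeff k f a - polar_coeff k g a"
  by (subst polar_coeff_eqI[OF has_laurent_expansion_diff[OF assms[THEN meromorphic_has_laurent_expansion]]])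
     (simp add: polar_coeff_def)

lemma polar_coeff_cmult:
  assumes "f meromorphic_on UNIV"
  shows "polar_coeff k (\<lambda>z. c * f z) a = c * polar_coeff k f a"
  by (subst polar_coeff_eqI[OF has_laurent_expansion_cmult_left[OF meromorphic_has_laurent_expansion[OF assms]]])
     (simp add: polar_coeff_def)

lemma polar_coeff_sum:
  assumes "\<And>i. i \<in> I \<Longrightarrow> f i meromorphic_on UNIV"
  shows "polar_coeff k (\<lambda>z. \<Sum>i\<in>I. f i z) a = (\<Sum>i\<in>I. polar_coeff k (f i) a)"
proof -
  have "(\<lambda>x. \<Sum>i\<in>I. f i (a + x)) has_laurent_expansion (\<Sum>i\<in>I. laurent_expansion (f i) a)"
    by (intro has_laurent_expansion_sum meromorphic_has_laurent_expansion assms)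
  then have "polar_coeff k (\<lambda>z. \<Sum>i\<in>I. f i z) a = fls_nth (\<Sum>i\<in>I. laurent_expansion (f i) a) (- int k)"
    by (rule polar_coeff_eqI)
  also have "\<dots> = (\<Sum>i\<in>I. polar_coeff k (f i) a)"
    by (induction I rule: infinite_finite_induct) (auto simp: polar_coeff_def)
  finally show ?thesis .
qed

lemma polar_coeff_translate:
  assumes "f meromorphic_on UNIV"
  shows "polar_coeff k (\<lambda>z. f (z + c)) a = polar_coeff k f (a + c)"
  using polar_coeff_eqI[of "\<lambda>z. f (z + c)" a] meromorphic_has_laurent_expansion[OF assms, of "a + c"]
  by (simp add: polar_coeff_def add_ac)

text \<open>True without differentiability: both sides choose from the same set of
  derivatives.\<close>

lemma deriv_translate: "deriv (\<lambda>z. f (z + c)) z = deriv f (z + c)"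
  by (simp add: deriv_def DERIV_shift)

text \<open>Termwise differentiation of the Laurent series. The case \<open>k = 0\<close> says that
  a derivative has no residue.\<close>

lemma polar_coeff_deriv:
  assumes "f meromorphic_on UNIV"
  shows "polar_coeff (Suc k) (deriv f) a = - of_nat k * polar_coeff k f a"
proof -
  have "deriv (\<lambda>x. f (a + x)) has_laurent_expansion fls_deriv (laurent_expansion f a)"
    by (rule has_laurent_expansion_deriv[OF meromorphic_has_laurent_expansion[OF assms]])
  moreover have "deriv (\<lambda>x. f (a + x)) = (\<lambda>x. deriv f (a + x))"
    using deriv_translate[of f a] by (simp add: fun_eq_iff add.commute[of a])
  ultimately show ?thesis
    using polar_coeff_eqI[of "deriv f" a "fls_deriv (laurent_expansion f a)" "Suc k"]
    by (simp add: polar_coeff_def)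
qed

lemma polar_coeff_analytic:
  assumes "f analytic_on {a}" "k \<ge> 1"
  shows "polar_coeff k f a = 0"
proof -
  obtain F where "(\<lambda>x. f (a + x)) has_fps_expansion F"
    using analytic_at_imp_has_fps_expansion[OF assms(1)] by blast
  then have "(\<lambda>x. f (a + x)) has_laurent_expansion fps_to_fls F"
    by (rule has_laurent_expansion_fps)
  from polar_coeff_eqI[OF this] show ?thesis
    using assms(2) by simp
qed

lemma polar_coeff_large_eq_0: "\<exists>K. \<forall>k\<ge>K. polar_coeff k f a = 0"
proof (intro exI allI impI)
  fix k assume "nat (1 - fls_subdegree (laurent_expansion f a)) \<le> k"
  then show "polar_coeff k f a = 0"
    unfolding polar_coeff_def by (intro fls_eq0_below_subdegree) linarith
qed

lemma not_is_pole_if_polar_coeffs_0: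
  assumes "f meromorphic_on UNIV" "\<And>k. k \<ge> 1 \<Longrightarrow> polar_coeff k f a = 0"
  shows "\<not> is_pole f a"
proof
  let ?F = "laurent_expansion f a"
  assume "is_pole f a"
  then have neg: "fls_subdegree ?F < 0"
    using is_pole_fls_subdegree_iff[OF meromorphic_has_laurent_expansion[OF assms(1)]] by simp
  then have "fls_nth ?F (fls_subdegree ?F) \<noteq> 0"
    by (intro nth_fls_subdegree_nonzero) auto
  moreover have "nat (- fls_subdegree ?F) \<ge> 1"
    using neg by linarith
  ultimately show False
    using assms(2)[of "nat (- fls_subdegree ?F)"] neg by (simp add: polar_coeff_def)
qed

section \<open>Quasi-periods of zeta and the functions obtained from its derivatives\<close>

context complex_lattice
begin

text \<open>Off the lattice the increment \<open>D\<close> is affine, by its second divided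
  differences. Oddness of zeta makes \<open>D\<close> symmetric under \<open>z -> - a - z\<close>,
  and an affine function with this symmetry has slope 0.\<close>

lemma zeta_translate_ex:
  assumes "a \<in> L"
  shows "\<exists>e. \<forall>z. z \<notin> L \<longrightarrow> zeta (z + a) = zeta z + e"
proof -
  define D where "D = (\<lambda>z. zeta (z + a) - zeta z)"
  \<comment> \<open>Two distinct interpolation nodes off the lattice; they determine the affine
    function.\<close>
  define w u where "w = w1 / 2" and "u = w2 / 2"
  have wu: "w \<notin> L" "u \<notin> L"
    using half_period_not_in_lattice by (auto simp: w_def u_def)
  have "w1 \<noteq> w2"
    using indep[of 1 "- 1"] by auto
  then have "w \<noteq> u"
    by (simp add: w_def u_def)
  define A where "A = (D w - D u) / (w - u)"
  define B where "B = D w - A * w"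
  have affine: "D z = A * z + B" if "z \<notin> L" for z
  proof -
    consider "z = w" | "z = u" | "z \<noteq> w" "z \<noteq> u" by blast
    then show ?thesis
    proof cases
      case 1
      then show ?thesis by (simp add: B_def)
    next
      case 2
      have "A * (w - u) = D w - D u"
        using \<open>w \<noteq> u\<close> by (simp add: A_def)
      then show ?thesis
        using 2 by (simp add: B_def algebra_simps)
    next
      case 3
      have nz: "z - w \<noteq> 0" "z - u \<noteq> 0" "w - u \<noteq> 0" "w - z \<noteq> 0" "u - z \<noteq> 0" "u - w \<noteq> 0"
        using 3 \<open>w \<noteq> u\<close> by auto
      have "D z / ((z - w) * (z - u)) + D w / ((w - z) * (w - u)) + D u / ((u - z) * (u - w)) = 0"
        using zeta_second_difference_periodic[OF that wu 3 \<open>w \<noteq> u\<close> assms] by (simp add: D_def)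
      moreover have "(z - w) * (z - u) * (Dz / ((z - w) * (z - u)) + Dw / ((w - z) * (w - u)) +
          Du / ((u - z) * (u - w))) = Dz - ((Dw - Du) / (w - u) * z + (Dw - (Dw - Du) / (w - u) * w))"
        for Dz Dw Du
        using nz by (simp add: divide_simps) (simp add: algebra_simps)
      ultimately have "D z - (A * z + B) = 0"
        unfolding A_def B_def by (metis mult_zero_right)
      then show ?thesis by simp
    qed
  qed
  have symmetric: "A * (2 * z + a) = 0" if z: "z \<notin> L" for z
  proof -
    have "- a - z \<notin> L"
      using z lattice_add_iff[OF assms, of "- a - z"] by auto
    moreover have "D (- a - z) = D z"
      using zeta_odd[of z] zeta_odd[of "a + z"] by (simp add: D_def add.commute[of z a])
    ultimately have "A * (- a - z) + B = A * z + B"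
      using affine z by metis
    then show ?thesis
      by algebra
  qed
  have "A = 0"
  proof (rule ccontr)
    assume "A \<noteq> 0"
    then have "2 * w + a = 0" "2 * u + a = 0"
      using symmetric wu by auto
    then have "2 * w = 2 * u"
      by (metis add_right_cancel)
    then show False
      using \<open>w \<noteq> u\<close> by simp
  qed
  then have "zeta (z + a) = zeta z + B" if "z \<notin> L" for z
    using affine[OF that] by (simp add: D_def algebra_simps)
  then show ?thesis by blast
qed

text \<open>The classical Weierstrass eta function of the lattice; its value is meaningful only for
  \<open>a\<close> in \<open>L\<close>.\<close>

definition quasi_period :: "complex \<Rightarrow> complex" where
  "quasi_period a = (SOME e. \<forall>z. z \<notin> L \<longrightarrow> zeta (z + a) = zeta z + e)"

lemma zeta_translate: "a \<in> L \<Longrightarrow> z \<notin> L \<Longrightarrow> zeta (z + a) = zeta z + quasi_period a"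
  using someI_ex[OF zeta_translate_ex[of a]] unfolding quasi_period_def by blast

lemma zeta_meromorphic: "zeta meromorphic_on UNIV"
proof (subst meromorphic_on_meromorphic_at, intro ballI)
  fix a :: complex
  obtain h where h: "h analytic_on {a}"
    and ev: "eventually (\<lambda>z. zeta z = (if a \<in> L then 1 / (z - a) else 0) + h z) (nhds a)"
    using zeta_minus_principal_part_analytic by blast
  have "(\<lambda>z. (if a \<in> L then 1 / (z - a) else 0) + h z) meromorphic_on {a}"
    by (cases "a \<in> L") (auto intro!: meromorphic_intros analytic_on_imp_meromorphic_on[OF h])
  moreover have "eventually (\<lambda>z. zeta z = (if a \<in> L then 1 / (z - a) else 0) + h z) (at a)"
    using ev unfolding eventually_at_filter by eventually_elim simp
  ultimately show "zeta meromorphic_on {a}"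
    by (subst meromorphic_on_cong[OF _ refl]) auto
qed

lemma polar_coeff_zeta:
  assumes "j \<ge> 1"
  shows "polar_coeff j zeta a = (if a \<in> L \<and> j = 1 then 1 else 0)"
proof (cases "a \<in> L")
  case False
  then show ?thesis
    using zeta_analytic polar_coeff_analytic assms by simp
next
  case True
  obtain h where h: "h analytic_on {a}" and ev: "eventually (\<lambda>z. zeta z = 1 / (z - a) + h z) (nhds a)"
    using zeta_minus_principal_part_analytic[of a] True by auto
  obtain H where "(\<lambda>x. h (a + x)) has_fps_expansion H"
    using analytic_at_imp_has_fps_expansion[OF h] by blast
  then have "(\<lambda>x. h (a + x)) has_laurent_expansion fps_to_fls H"
    by (rule has_laurent_expansion_fps)
  then have "(\<lambda>x. inverse x + h (a + x)) has_laurent_expansion fls_X_inv + fps_to_fls H"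
    by (intro has_laurent_expansion_add has_laurent_expansion_fls_X_inv)
  then have "polar_coeff j (\<lambda>z. 1 / (z - a) + h z) a = fls_nth (fls_X_inv + fps_to_fls H) (- int j)"
    by (intro polar_coeff_eqI) (simp add: divide_inverse)
  moreover have "polar_coeff j zeta a = polar_coeff j (\<lambda>z. 1 / (z - a) + h z) a"
    using ev by (intro polar_coeff_cong) (auto simp: eventually_at_filter elim: eventually_mono)
  ultimately show ?thesis
    using assms True by auto
qed

text \<open>Scaled so that the principal part at each lattice point \<open>l\<close> is exactly
  \<open>(z - l)^(-k)\<close>; the coefficients of a combination are then its polar
  coefficients.\<close>

definition zeta_basis :: "nat \<Rightarrow> complex \<Rightarrow> complex" where
  "zeta_basis k z = (- 1) ^ (k - 1) / fact (k - 1) * (deriv ^^ (k - 1)) zeta z"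

lemma zeta_basis_meromorphic: "zeta_basis k meromorphic_on UNIV"
  unfolding zeta_basis_def [abs_def] by (intro meromorphic_intros zeta_meromorphic)

lemma polar_coeff_zeta_basis:
  assumes "j \<ge> 1" "k \<ge> 1"
  shows "polar_coeff j (zeta_basis k) a = (if a \<in> L \<and> j = k then 1 else 0)"
proof -
  have *: "polar_coeff j ((deriv ^^ n) zeta) a = (if a \<in> L \<and> j = Suc n then (- 1) ^ n * fact n else 0)"
    if "j \<ge> 1" for n j
    using that
  proof (induction n arbitrary: j)
    case 0
    then show ?case by (simp add: polar_coeff_zeta)
  next
    case (Suc n)
    then obtain i where j: "j = Suc i" by (cases j) auto
    have mero: "(deriv ^^ n) zeta meromorphic_on UNIV"
      by (intro meromorphic_intros zeta_meromorphic)
    \<comment> \<open>The induction hypothesis speaks of \<open>i \<ge> 1\<close>; for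
      \<open>i = 0\<close> the claim is the vanishing residue of a derivative.\<close>
    show ?case
      using Suc.IH[of i] polar_coeff_deriv[OF mero, of i a] by (cases "i = 0") (auto simp: j)
  qed
  have "(deriv ^^ (k - 1)) zeta meromorphic_on UNIV"
    by (intro meromorphic_intros zeta_meromorphic)
  then show ?thesis
    unfolding zeta_basis_def [abs_def] using *[OF assms(1), of "k - 1"] assms(2)
    by (subst polar_coeff_cmult) (auto simp flip: power_add mult_2)
qed

text \<open>The quasi-period is an additive constant and disappears at the first differentiation.
  Differentiating an equation requires it on a neighbourhood, so the induction ranges over all
  \<open>z\<close> in the open complement of the lattice.\<close>

lemma zeta_basis_translate:
  assumes "a \<in> L" "k \<ge> 1" "z \<notin> L"
  shows "zeta_basis k (z + a) = zeta_basis k z + (if k = 1 then quasi_period a else 0)"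
proof -
  have *: "(deriv ^^ Suc n) zeta (z + a) = (deriv ^^ Suc n) zeta z" if "z \<notin> L" for n z
    using that
  proof (induction n arbitrary: z)
    case 0
    have "eventually (\<lambda>z. z \<in> - L) (nhds z)"
      using 0 closed_lattice by (intro eventually_nhds_in_open) auto
    then have "eventually (\<lambda>z. zeta (z + a) = zeta z + quasi_period a) (nhds z)"
      by eventually_elim (use assms(1) in \<open>auto simp: zeta_translate\<close>)
    then have "deriv (\<lambda>z. zeta (z + a)) z = deriv (\<lambda>z. zeta z + quasi_period a) z"
      by (intro deriv_cong_ev) auto
    also have "\<dots> = deriv zeta z"
      using zeta_analytic[OF 0] by (subst deriv_add) (auto simp: analytic_on_imp_differentiable_at)
    finally show ?case
      by (simp add: deriv_translate)
  next
    case (Suc n)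
    have "eventually (\<lambda>z. z \<in> - L) (nhds z)"
      using Suc.prems closed_lattice by (intro eventually_nhds_in_open) auto
    then have "eventually (\<lambda>z. (deriv ^^ Suc n) zeta (z + a) = (deriv ^^ Suc n) zeta z) (nhds z)"
      by eventually_elim (use Suc.IH in auto)
    then have "deriv (\<lambda>z. (deriv ^^ Suc n) zeta (z + a)) z = deriv ((deriv ^^ Suc n) zeta) z"
      by (intro deriv_cong_ev) auto
    then show ?case
      by (simp add: deriv_translate[where f = "(deriv ^^ Suc n) zeta", simplified])
  qed
  show ?thesis
  proof (cases "k = 1")
    case True
    then show ?thesis
      using assms by (simp add: zeta_basis_def zeta_translate)
  next
    case False
    then have "k - 1 = Suc (k - 2)"
      using assms(2) by simp
    then show ?thesis
      using False *[OF assms(3), of "k - 2"] by (simp add: zeta_basis_def)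
  qed
qed

end

section \<open>Expansion of elliptic functions\<close>

lemma eventually_at_translate:
  fixes c x :: complex
  shows "eventually (\<lambda>z. P (z + c)) (at x) \<longleftrightarrow> eventually P (at (x + c))"
  unfolding at_to_0[of x] at_to_0[of "x + c"] by (simp add: eventually_filtermap add_ac)

lemma is_pole_translate: "is_pole (\<lambda>z :: complex. f (z + c)) x \<longleftrightarrow> is_pole f (x + c)"
  unfolding is_pole_def at_to_0[of x] at_to_0[of "x + c"] by (simp add: filterlim_filtermap add_ac)

context complex_lattice
begin

text \<open>The derivative is periodic, so all its values are taken on a compact disc, and
  Liouville's theorem makes it constant.\<close>

lemma entire_quasi_periodic_imp_affine:
  assumes hol: "H holomorphic_on UNIV"
    and quasi: "\<And>a z. a \<in> L \<Longrightarrow> H (z + a) = H z + e a"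
  obtains A B where "\<And>z. H z = A * z + B"
proof -
  have periodic: "deriv H (z + a) = deriv H z" if "a \<in> L" for a z
  proof -
    have "deriv H (z + a) = deriv (\<lambda>z. H (z + a)) z"
      by (rule deriv_translate [symmetric])
    also have "\<dots> = deriv (\<lambda>z. H z + e a) z"
      using quasi[OF that] by simp
    also have "\<dots> = deriv H z"
      using hol by (subst deriv_add) (auto simp: holomorphic_on_def field_differentiable_def
          intro: holomorphic_on_imp_differentiable_at)
    finally show ?thesis .
  qed
  have hol': "deriv H holomorphic_on UNIV"
    using hol by (intro holomorphic_deriv) auto
  have "range (deriv H) \<subseteq> deriv H ` cball 0 (cmod w1 + cmod w2)"
  proof safe
    fix z
    obtain a where "a \<in> L" "z + a \<in> cball 0 (cmod w1 + cmod w2)"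
      using translate_into_compact by blast
    then show "deriv H z \<in> deriv H ` cball 0 (cmod w1 + cmod w2)"
      using periodic by (metis imageI)
  qed
  moreover have "compact (deriv H ` cball 0 (cmod w1 + cmod w2))"
    using hol' by (intro compact_continuous_image holomorphic_on_imp_continuous_on)
      (auto intro: holomorphic_on_subset)
  ultimately have "bounded (range (deriv H))"
    using bounded_subset compact_imp_bounded by blast
  then have "deriv H constant_on UNIV"
    using Liouville_theorem hol' by blast
  then obtain A where A: "\<And>z. deriv H z = A"
    unfolding constant_on_def by blast
  have "((\<lambda>z. H z - A * z) has_field_derivative 0) (at z)" for z
  proof -
    have "(H has_field_derivative A) (at z)"
      using hol A holomorphic_derivI[of H UNIV z] by simp
    then show ?thesis
      by (auto intro!: derivative_eq_intros)
  qed
  then have "\<exists>B. \<forall>z\<in>UNIV. H z - A * z = B"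
    by (intro has_field_derivative_zero_constant) auto
  then show ?thesis
    using that[of A] by (metis UNIV_I diff_add_cancel add.commute)
qed

text \<open>Without poles \<open>remove_sings h\<close> is entire, and continuity extends the
  quasi-period equation to every point; at 0 it gives \<open>A * a = e a\<close>. That conclusion
  drives the applications, since it makes \<open>e\<close> linear.\<close>

lemma meromorphic_quasi_periodic_imp_affine:
  assumes mero: "h meromorphic_on UNIV" and no_pole: "\<And>a. \<not> is_pole h a"
    and quasi: "\<And>a x. a \<in> L \<Longrightarrow> eventually (\<lambda>z. h (z + a) = h z + e a) (at x)"
  obtains A B where "\<And>x. eventually (\<lambda>z. h z = A * z + B) (at x)" "\<And>a. a \<in> L \<Longrightarrow> A * a = e a"
proof -
  define H where "H = remove_sings h"
  have "H nicely_meromorphic_on UNIV"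
    unfolding H_def by (rule remove_sings_nicely_meromorphic[OF mero])
  moreover have "\<not> is_pole H a" for a
    using no_pole[of a] mero unfolding H_def
    by (subst is_pole_remove_sings_iff) (auto simp: meromorphic_on_altdef)
  ultimately have an: "H analytic_on UNIV"
    by (intro nicely_meromorphic_without_singularities) auto
  then have hol: "H holomorphic_on UNIV"
    by (rule analytic_imp_holomorphic)
  have ev: "eventually (\<lambda>z. H z = h z) (at x)" for x
    unfolding H_def using mero by (intro eventually_remove_sings_eq_at) (auto simp: meromorphic_on_altdef)
  have H_quasi: "H (z + a) = H z + e a" if a: "a \<in> L" for a z
  proof -
    have "eventually (\<lambda>z. H (z + a) = h (z + a)) (at z)"
      using ev by (subst eventually_at_translate)
    with ev[of z] quasi[OF a, of z] have *: "eventually (\<lambda>z. H (z + a) = H z + e a) (at z)"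
      by eventually_elim simp
    have cont: "continuous_on UNIV H"
      using hol by (rule holomorphic_on_imp_continuous_on)
    have "continuous_on UNIV (\<lambda>z. H (z + a))" "continuous_on UNIV (\<lambda>z. H z + e a)"
      by (intro continuous_intros continuous_on_compose2[OF cont]; simp)+
    then have "((\<lambda>z. H (z + a)) \<longlongrightarrow> H (z + a)) (at z)" "((\<lambda>z. H z + e a) \<longlongrightarrow> H z + e a) (at z)"
      by (auto simp: continuous_on_def)
    moreover have "((\<lambda>z. H (z + a)) \<longlongrightarrow> H z + e a) (at z) \<longleftrightarrow> ((\<lambda>z. H z + e a) \<longlongrightarrow> H z + e a) (at z)"
      by (rule tendsto_cong[OF *])
    ultimately show ?thesis
      by (metis tendsto_unique trivial_limit_at)
  qed
  obtain A B where AB: "\<And>z. H z = A * z + B"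
    using entire_quasi_periodic_imp_affine[OF hol H_quasi] by blast
  show ?thesis
  proof
    show "eventually (\<lambda>z. h z = A * z + B) (at x)" for x
      using ev[of x] by eventually_elim (simp add: AB)
    show "A * a = e a" if "a \<in> L" for a
      using H_quasi[OF that, of 0] by (simp add: AB)
  qed
qed

text \<open>
  If the quasi-periods were linear, \<open>g z = zeta z - c * z\<close> would be an odd elliptic function with a
  single simple pole. It vanishes at the half periods, so \<open>g z * g (z + w1 / 2)\<close> has no poles, is
  constant, and is zero at \<open>w2 / 2\<close>. This replaces the residue theorem on a period parallelogram.
\<close>

lemma quasi_period_not_linear:
  assumes lin: "\<And>a. a \<in> L \<Longrightarrow> quasi_period a = c * a"
  shows False
proof -
  define g where "g = (\<lambda>z. zeta z - c * z)"
  define v where "v = w1 / 2"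
  define p where "p = (\<lambda>z. g z * g (z + v))"
  have per: "g (z + a) = g z" if "a \<in> L" "z \<notin> L" for a z
    using zeta_translate[OF that] lin[OF that(1)] by (simp add: g_def algebra_simps)
  have odd: "g (- z) = - g z" for z
    by (simp add: g_def zeta_odd)
  have half: "g (a / 2) = 0" if "a \<in> L" "a / 2 \<notin> L" for a
  proof -
    have "g (- (a / 2) + a) = g (- (a / 2))"
      using that by (intro per) auto
    then show ?thesis
      by (simp add: odd)
  qed
  have vL: "v \<notin> L"
    using half_period_not_in_lattice by (simp add: v_def)
  have g_an: "g analytic_on {x}" if "x \<notin> L" for x
    unfolding g_def using zeta_analytic[OF that] by (intro analytic_intros)
  have g_mero: "g meromorphic_on UNIV"
    unfolding g_def by (intro meromorphic_intros zeta_meromorphic)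
  have p_mero: "p meromorphic_on UNIV"
    unfolding p_def by (intro meromorphic_intros g_mero meromorphic_on_translate)
  have g_shift_an: "(\<lambda>z. g (z + v)) analytic_on {x}" if "x + v \<notin> L" for x
  proof -
    have "(\<lambda>z. z + v) analytic_on {x}"
      by (intro analytic_intros)
    then show ?thesis
      using analytic_on_compose_gen[of "\<lambda>z. z + v" "{x}" g "{x + v}"] g_an[OF that] by (simp add: o_def)
  qed
  have p_an: "p analytic_on {x}" if "x \<notin> L" "x + v \<notin> L" for x
    unfolding p_def using that by (intro analytic_on_mult g_an g_shift_an)
  have no_pole_L: "\<not> is_pole p x" if x: "x \<in> L" for x
  proof
    assume pole: "is_pole p x"
    have xv: "x + v \<notin> L"
      using x vL lattice_add_iff[of x v] by (simp add: add.commute)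
    obtain h where h: "h analytic_on {x}" and ev: "eventually (\<lambda>z. zeta z = 1 / (z - x) + h z) (nhds x)"
      using zeta_minus_principal_part_analytic[of x] x by auto
    have "isCont (\<lambda>z. 1 + (z - x) * (h z - c * z)) x"
      using analytic_at_imp_isCont[OF h] by (intro continuous_intros)
    then have "((\<lambda>z. 1 + (z - x) * (h z - c * z)) \<longlongrightarrow> 1) (at x)"
      by (auto simp: isCont_def)
    moreover have "eventually (\<lambda>z. (z - x) * g z = 1 + (z - x) * (h z - c * z)) (at x)"
      using ev unfolding eventually_at_filter by eventually_elim (auto simp: g_def algebra_simps)
    ultimately have lim1: "((\<lambda>z. (z - x) * g z) \<longlongrightarrow> 1) (at x)"
      using tendsto_cong by force
    have "g (v + x) = g v"
      using x vL by (rule per)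
    then have zero: "g (x + v) = 0"
      using half[of w1] vL by (simp add: v_def add.commute)
    obtain D where "((\<lambda>z. g (z + v)) has_field_derivative D) (at x)"
      using g_shift_an[OF xv] analytic_on_imp_differentiable_at[of _ "{x}" x] field_differentiable_def by blast
    then have lim2: "((\<lambda>z. g (z + v) / (z - x)) \<longlongrightarrow> D) (at x)"
      by (simp add: has_field_derivative_iff zero)
    have "((\<lambda>z. ((z - x) * g z) * (g (z + v) / (z - x))) \<longlongrightarrow> 1 * D) (at x)"
      by (rule tendsto_mult[OF lim1 lim2])
    moreover have "eventually (\<lambda>z. ((z - x) * g z) * (g (z + v) / (z - x)) = p z) (at x)"
      by (auto simp: eventually_at_filter p_def)
    ultimately have "(p \<longlongrightarrow> 1 * D) (at x)"
      using tendsto_cong by force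
    then show False
      using pole unfolding is_pole_def by (metis not_tendsto_and_filterlim_at_infinity trivial_limit_at)
  qed
  have no_pole: "\<not> is_pole p x" for x
  proof -
    consider "x \<in> L" | "x + v \<in> L" | "x \<notin> L" "x + v \<notin> L" by blast
    then show ?thesis
    proof cases
      case 2
      \<comment> \<open>Translation by \<open>v\<close> exchanges the two factors up to the period
        \<open>w1\<close>, so a pole at \<open>x\<close> would give one at the lattice point
        \<open>x + v\<close>.\<close>
      have "eventually (\<lambda>z. p z = p (z + v)) (at x)"
        using eventually_not_in_lattice
      proof eventually_elim
        case (elim z)
        have "z + v + v = z + w1"
          by (simp add: v_def)
        then have "g (z + v + v) = g z"
          using per[OF w1_in_lattice elim] by (rule ssubst)
        then show ?case
          unfolding p_def by (simp only: mult.commute)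
      qed
      then have "is_pole p x \<longleftrightarrow> is_pole (\<lambda>z. p (z + v)) x"
        by (intro is_pole_cong) auto
      then show ?thesis
        using no_pole_L[OF 2] is_pole_translate by blast
    qed (use no_pole_L p_an analytic_at_imp_no_pole in blast)+
  qed
  have "eventually (\<lambda>z. p (z + a) = p z + 0) (at x)" if "a \<in> L" for a x
    using eventually_diff_not_in_lattice[of 0] eventually_diff_not_in_lattice[of "- v"]
  proof eventually_elim
    case (elim z)
    then show ?case
      using per[OF that, of z] per[OF that, of "z + v"] by (simp add: p_def add_ac)
  qed
  then obtain A B where AB: "\<And>x. eventually (\<lambda>z. p z = A * z + B) (at x)" "\<And>a. a \<in> L \<Longrightarrow> A * a = 0"
    using meromorphic_quasi_periodic_imp_affine[OF p_mero no_pole, of "\<lambda>_. 0"] by blast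
  have "w1 \<noteq> 0"
    using indep[of 1 0] by auto
  then have "A = 0"
    using AB(2)[of w1] by simp
  define x where "x = w2 / 2"
  have x: "x \<notin> L" "x + v \<notin> L"
    using half_period_not_in_lattice by (auto simp: x_def v_def add_divide_distrib add.commute)
  have "p x = 0"
    using half[of w2] half_period_not_in_lattice by (simp add: p_def x_def)
  moreover have "(p \<longlongrightarrow> p x) (at x)"
    using p_an[OF x] analytic_at_imp_isCont isCont_def by blast
  moreover have "(p \<longlongrightarrow> B) (at x)"
    using AB(1)[of x] \<open>A = 0\<close> by (intro tendsto_eventually) simp
  ultimately have "B = 0"
    by (metis tendsto_unique trivial_limit_at)
  have p0: "eventually (\<lambda>z. p z = 0) (at 0)"
    using AB(1)[of 0] \<open>A = 0\<close> \<open>B = 0\<close> by simp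
  \<comment> \<open>If \<open>g\<close> is zero off a sparse set, this contradicts its residue 1 at
    0. If it is nonzero off a sparse set, so is each factor of \<open>p\<close> near 0, although
    \<open>p\<close> vanishes there.\<close>
  consider "\<forall>\<^sub>\<approx>z\<in>UNIV. g z = 0" | "\<forall>\<^sub>\<approx>z\<in>UNIV. g z \<noteq> 0"
    using meromorphic_imp_constant_or_avoid[OF g_mero] by auto
  then show False
  proof cases
    case 1
    then have "eventually (\<lambda>z. g z = 0) (at 0)"
      by (simp add: eventually_cosparse_open_eq)
    then have "polar_coeff 1 g 0 = polar_coeff 1 (\<lambda>_. 0) 0"
      by (rule polar_coeff_cong)
    also have "\<dots> = 0"
      by (rule polar_coeff_analytic) auto
    finally have "polar_coeff 1 g 0 = 0" .
    moreover have "polar_coeff 1 g 0 = polar_coeff 1 zeta 0 - polar_coeff 1 (\<lambda>z. c * z) 0"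
      unfolding g_def by (intro polar_coeff_diff zeta_meromorphic meromorphic_intros)
    moreover have "polar_coeff 1 (\<lambda>z. c * z) 0 = 0"
      by (rule polar_coeff_analytic) (auto intro!: analytic_intros)
    ultimately show False
      by (simp add: polar_coeff_zeta)
  next
    case 2
    then have g: "eventually (\<lambda>z. g z \<noteq> 0) (at y)" for y
      by (simp add: eventually_cosparse_open_eq)
    have "eventually (\<lambda>z. g (z + v) \<noteq> 0) (at 0)"
      by (subst eventually_at_translate) (rule g)
    with g[of 0] p0 have "eventually (\<lambda>z :: complex. False) (at 0)"
      by eventually_elim (simp add: p_def)
    then show False by simp
  qed
qed

section \<open>Finite zeta combinations and the expansion theorem\<close>

definition zeta_sum ::
    "'i set \<Rightarrow> nat \<Rightarrow> ('i \<Rightarrow> complex) \<Rightarrow> ('i \<Rightarrow> nat \<Rightarrow> complex) \<Rightarrow> complex \<Rightarrow> complex" where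
  "zeta_sum I N \<beta> d z = (\<Sum>i\<in>I. \<Sum>k=1..N. d i k * zeta_basis k (z - \<beta> i))"

lemma zeta_basis_minus_meromorphic: "(\<lambda>z. zeta_basis k (z - b)) meromorphic_on UNIV"
  using meromorphic_on_translate[OF zeta_basis_meromorphic, of k "- b"] by simp

lemma zeta_sum_meromorphic: "zeta_sum I N \<beta> d meromorphic_on UNIV"
  unfolding zeta_sum_def [abs_def] by (intro meromorphic_intros zeta_basis_minus_meromorphic)

lemma polar_coeff_zeta_sum:
  assumes "j \<ge> 1"
  shows "polar_coeff j (zeta_sum I N \<beta> d) a = (\<Sum>i\<in>I. if a - \<beta> i \<in> L \<and> j \<le> N then d i j else 0)"
proof -
  have basis: "polar_coeff j (\<lambda>z. zeta_basis k (z - b)) a = (if a - b \<in> L \<and> j = k then 1 else 0)"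
    if "k \<in> {1..N}" for k b
    using polar_coeff_translate[OF zeta_basis_meromorphic, of j k "- b" a] that assms
    by (simp add: polar_coeff_zeta_basis)
  have mero: "(\<lambda>z. c * zeta_basis k (z - b)) meromorphic_on UNIV" for c k b
    by (intro meromorphic_on_mult meromorphic_on_const zeta_basis_minus_meromorphic)
  have "polar_coeff j (zeta_sum I N \<beta> d) a =
      (\<Sum>i\<in>I. \<Sum>k=1..N. d i k * polar_coeff j (\<lambda>z. zeta_basis k (z - \<beta> i)) a)"
    unfolding zeta_sum_def [abs_def]
    by (simp only: polar_coeff_sum polar_coeff_cmult zeta_basis_minus_meromorphic mero meromorphic_on_sum)
  also have "\<dots> = (\<Sum>i\<in>I. if a - \<beta> i \<in> L \<and> j \<le> N then d i j else 0)"
  proof (rule sum.cong[OF refl])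
    fix i
    have "(\<Sum>k=1..N. d i k * polar_coeff j (\<lambda>z. zeta_basis k (z - \<beta> i)) a) =
        (\<Sum>k=1..N. if k = j then (if a - \<beta> i \<in> L then d i j else 0) else 0)"
      by (intro sum.cong refl) (simp add: basis)
    also have "\<dots> = (if a - \<beta> i \<in> L \<and> j \<le> N then d i j else 0)"
      using assms by (simp add: sum.delta)
    finally show "(\<Sum>k=1..N. d i k * polar_coeff j (\<lambda>z. zeta_basis k (z - \<beta> i)) a) =
        (if a - \<beta> i \<in> L \<and> j \<le> N then d i j else 0)" .
  qed
  finally show ?thesis .
qed

text \<open>Only the terms with \<open>k = 1\<close> see a quasi-period, so a single number
  obstructs periodicity for all periods at once.\<close>

lemma zeta_sum_translate:
  assumes "a \<in> L" "\<And>i. i \<in> I \<Longrightarrow> z - \<beta> i \<notin> L" "N \<ge> 1"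
  shows "zeta_sum I N \<beta> d (z + a) = zeta_sum I N \<beta> d z + quasi_period a * (\<Sum>i\<in>I. d i 1)"
proof -
  have "(\<Sum>k=1..N. d i k * zeta_basis k (z + a - \<beta> i)) =
      (\<Sum>k=1..N. d i k * zeta_basis k (z - \<beta> i)) + quasi_period a * d i 1" if i: "i \<in> I" for i
  proof -
    have "zeta_basis k (z + a - \<beta> i) = zeta_basis k (z - \<beta> i) + (if k = 1 then quasi_period a else 0)"
      if "k \<in> {1..N}" for k
      using zeta_basis_translate[of a k "z - \<beta> i"] assms i that by (simp add: algebra_simps)
    then have "(\<Sum>k=1..N. d i k * zeta_basis k (z + a - \<beta> i)) =
      (\<Sum>k=1..N. d i k * zeta_basis k (z - \<beta> i) + (if k = 1 then quasi_period a * d i k else 0))"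
      by (intro sum.cong) (auto simp: algebra_simps)
    then show ?thesis
      using assms(3) by (simp add: sum.distrib sum.delta)
  qed
  then show ?thesis
    by (simp add: zeta_sum_def sum.distrib sum_distrib_left)
qed

lemma eventually_zeta_sum_translate:
  assumes "finite I" "a \<in> L" "N \<ge> 1"
  shows "eventually (\<lambda>z. zeta_sum I N \<beta> d (z + a) = zeta_sum I N \<beta> d z + quasi_period a * (\<Sum>i\<in>I. d i 1)) (at x)"
proof -
  have "eventually (\<lambda>z. \<forall>i\<in>I. z - \<beta> i \<notin> L) (at x)"
    using assms(1) by (intro eventually_ball_finite ballI eventually_diff_not_in_lattice)
  then show ?thesis
    by (rule eventually_mono) (rule zeta_sum_translate[OF assms(2) _ assms(3)], simp)
qed

text \<open>The remainder \<open>h\<close> has no poles and increments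
  \<open>- (quasi_period a * R)\<close>, hence is affine with slope \<open>A\<close> satisfying
  \<open>A * a = - (quasi_period a * R)\<close>. If \<open>R \<noteq> 0\<close>, the quasi-periods
  would be linear; and \<open>R = 0\<close> forces \<open>A = 0\<close>.\<close>

lemma elliptic_zeta_expansion:
  assumes mero: "f meromorphic_on UNIV" and per: "\<forall>z. \<forall>a\<in>L. f (z + a) = f z"
    and fin: "finite I" and N: "N \<ge> 1"
    and inj: "\<And>i j. i \<in> I \<Longrightarrow> j \<in> I \<Longrightarrow> \<beta> i - \<beta> j \<in> L \<Longrightarrow> i = j"
    and poles: "\<And>a k. k \<ge> 1 \<Longrightarrow> polar_coeff k f a \<noteq> 0 \<Longrightarrow> k \<le> N \<and> (\<exists>i\<in>I. a - \<beta> i \<in> L)"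
  shows "(\<Sum>i\<in>I. polar_coeff 1 f (\<beta> i)) = 0"
    and "\<exists>b. \<forall>x. eventually (\<lambda>z. f z = b + zeta_sum I N \<beta> (\<lambda>i k. polar_coeff k f (\<beta> i)) z) (at x)"
proof -
  define R where "R = (\<Sum>i\<in>I. polar_coeff 1 f (\<beta> i))"
  define G where "G = zeta_sum I N \<beta> (\<lambda>i k. polar_coeff k f (\<beta> i))"
  define h where "h = (\<lambda>z. f z - G z)"
  have G_mero: "G meromorphic_on UNIV"
    unfolding G_def by (rule zeta_sum_meromorphic)
  have h_mero: "h meromorphic_on UNIV"
    unfolding h_def by (intro meromorphic_intros mero G_mero)
  have "polar_coeff j h a = 0" if j: "j \<ge> 1" for j a
  proof -
    have "polar_coeff j G a = polar_coeff j f a"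
    proof (cases "j \<le> N \<and> (\<exists>i\<in>I. a - \<beta> i \<in> L)")
      case True
      then obtain i where i: "i \<in> I" "a - \<beta> i \<in> L" "j \<le> N" by blast
      have "a - \<beta> i' \<in> L \<longleftrightarrow> i' = i" if "i' \<in> I" for i'
        using inj[OF i(1) that] lattice_diff[OF _ i(2), of "a - \<beta> i'"] lattice_uminus_iff[of "\<beta> i - \<beta> i'"] i
        by auto
      then have "polar_coeff j G a = (\<Sum>i'\<in>I. if i' = i then polar_coeff j f (\<beta> i') else 0)"
        unfolding G_def polar_coeff_zeta_sum[OF j] using i by (intro sum.cong) auto
      also have "\<dots> = polar_coeff j f (\<beta> i)"
        using fin i by simp
      also have "\<dots> = polar_coeff j (\<lambda>z. f (z + (a - \<beta> i))) (\<beta> i)"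
        using per i(2) by simp
      also have "\<dots> = polar_coeff j f a"
        using polar_coeff_translate[OF mero] by simp
      finally show ?thesis .
    next
      case False
      then have "polar_coeff j G a = 0"
        unfolding G_def polar_coeff_zeta_sum[OF j] by (intro sum.neutral) auto
      then show ?thesis
        using False poles[OF j] by metis
    qed
    then show ?thesis
      unfolding h_def by (simp add: polar_coeff_diff mero G_mero)
  qed
  then have no_pole: "\<not> is_pole h a" for a
    by (intro not_is_pole_if_polar_coeffs_0 h_mero)
  have "eventually (\<lambda>z. h (z + a) = h z + - (quasi_period a * R)) (at x)" if "a \<in> L" for a x
    using eventually_zeta_sum_translate[OF fin that N, of \<beta> "\<lambda>i k. polar_coeff k f (\<beta> i)"]
    by eventually_elim (use per that in \<open>simp add: h_def G_def R_def\<close>)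
  then obtain A B where AB: "\<And>x. eventually (\<lambda>z. h z = A * z + B) (at x)"
    "\<And>a. a \<in> L \<Longrightarrow> A * a = - (quasi_period a * R)"
    using meromorphic_quasi_periodic_imp_affine[OF h_mero no_pole, of "\<lambda>a. - (quasi_period a * R)"] by blast
  have "R = 0"
  proof (rule ccontr)
    assume "R \<noteq> 0"
    then have "quasi_period a = (- A / R) * a" if "a \<in> L" for a
      using AB(2)[OF that] by (simp add: field_simps)
    then show False
      by (rule quasi_period_not_linear)
  qed
  then show "(\<Sum>i\<in>I. polar_coeff 1 f (\<beta> i)) = 0"
    by (simp add: R_def)
  have "w1 \<noteq> 0"
    using indep[of 1 0] by auto
  then have "A = 0"
    using AB(2)[of w1] \<open>R = 0\<close> by simp
  then have "eventually (\<lambda>z. h z = B) (at x)" for x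
    using AB(1)[of x] by simp
  then have "eventually (\<lambda>z. f z = B + G z) (at x)" for x
    by (rule eventually_mono) (simp add: h_def algebra_simps)
  then show "\<exists>b. \<forall>x. eventually (\<lambda>z. f z = b + zeta_sum I N \<beta> (\<lambda>i k. polar_coeff k f (\<beta> i)) z) (at x)"
    unfolding G_def by blast
qed

end

section \<open>Coefficients along orbits\<close>

lemma infsum_eq_sum:
  assumes "finite T" "T \<subseteq> X" "\<And>x. x \<in> X - T \<Longrightarrow> f x = 0"
  shows "infsum f X = sum f T"
proof -
  have "infsum f X = infsum f T"
    using assms by (intro infsum_cong_neutral) auto
  then show ?thesis
    using assms(1) by simp
qed

text \<open>For \<open>M \<ge> 0\<close>, moving the window one step drops \<open>- M\<close> and
  adds \<open>M + 1\<close>; \<open>u\<close> vanishes at both because the hypothesis includes the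
  endpoints.\<close>

lemma sum_shift_finite_support:
  fixes u v :: "int \<Rightarrow> complex"
  assumes "\<And>n. M \<le> \<bar>n\<bar> \<Longrightarrow> u n = 0"
  shows "(\<Sum>n=-M..M. u (n + 1) * v n) = (\<Sum>n=-M..M. u n * v (n - 1))"
proof -
  have "(\<Sum>n=-M..M. u (n + 1) * v n) = (\<Sum>n=-M+1..M+1. u n * v (n - 1))"
    by (rule sum.reindex_bij_witness[of _ "\<lambda>n. n - 1" "\<lambda>n. n + 1"]) auto
  also have "\<dots> = (\<Sum>n=-M+1..M. u n * v (n - 1))"
    using assms by (intro sum.mono_neutral_right) auto
  also have "\<dots> = (\<Sum>n=-M..M. u n * v (n - 1))"
    using assms by (intro sum.mono_neutral_left) auto
  finally show ?thesis .
qed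

text \<open>Applied with \<open>v n = 1\<close>, whose difference is 0, for the orbital residues,
  and with \<open>v n = n\<close>, whose difference is -1, for the first panorbital residue.\<close>

lemma sum_by_parts_finite_support:
  fixes u v :: "int \<Rightarrow> complex"
  assumes "\<And>n. M \<le> \<bar>n\<bar> \<Longrightarrow> u n = 0"
  shows "(\<Sum>n=-M..M. (u (n + 1) - u n) * v n) = (\<Sum>n=-M..M. u n * (v (n - 1) - v n))"
  using sum_shift_finite_support[OF assms] by (simp add: algebra_simps sum_subtractf)

lemma remove_sings_translate: "remove_sings (\<lambda>z. f (z + c)) x = remove_sings f (x + c)"
  by (subst (1 2) remove_sings_shift_0) (simp add: add_ac)

text \<open>At a pole both values are 0; elsewhere the function already equals its limit. This turns
  equality near a point into equality at the point.\<close>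

lemma nicely_meromorphic_remove_sings_eq:
  assumes "f nicely_meromorphic_on UNIV"
  shows "remove_sings f x = f x"
proof (cases "is_pole f x")
  case True
  then have "\<not> f \<midarrow>x\<rightarrow> f x"
    unfolding is_pole_def by (metis not_tendsto_and_filterlim_at_infinity trivial_limit_at)
  then show ?thesis
    using assms True by (auto simp: nicely_meromorphic_on_def)
next
  case False
  then show ?thesis
    using assms by (intro remove_sings_eqI) (auto simp: nicely_meromorphic_on_def)
qed

section \<open>Enumeration of the torus by pins\<close>

locale pinned_torus = complex_lattice +
  fixes s :: complex and \<alpha> :: "complex set set \<Rightarrow> complex"
  assumes non_torsion: "non_torsion L s" and pinning: "tau_pinning L s \<alpha>"
begin

abbreviation orbits :: "complex set set set" where
  "orbits \<equiv> tau_orbits L s"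

definition pin :: "complex set set \<Rightarrow> int \<Rightarrow> complex" where
  "pin \<omega> n = \<alpha> \<omega> + of_int n * s"

lemma torus_point_eq_iff: "torus_point L a = torus_point L b \<longleftrightarrow> a - b \<in> L"
proof
  assume "torus_point L a = torus_point L b"
  then have "a \<in> torus_point L b"
    unfolding torus_point_def using zero_in_lattice by (metis add.right_neutral imageI)
  then show "a - b \<in> L"
    by (auto simp: torus_point_def)
next
  assume ab: "a - b \<in> L"
  have "a + l \<in> torus_point L b" if "l \<in> L" for l
    unfolding torus_point_def using that ab
    by (intro image_eqI[of _ _ "a - b + l"]) (auto intro: lattice_add)
  moreover have "b + l \<in> torus_point L a" if "l \<in> L" for l
    unfolding torus_point_def using that ab
    by (intro image_eqI[of _ _ "l - (a - b)"]) (auto intro: lattice_diff)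
  ultimately show "torus_point L a = torus_point L b"
    by (auto simp: torus_point_def)
qed

lemma multiple_in_lattice_iff: "of_int n * s \<in> L \<longleftrightarrow> n = 0"
  using non_torsion torus_point_eq_iff[of "of_int n * s" 0] by (auto simp: non_torsion_def)

text \<open>Modulo the lattice the pinned point is \<open>t + m * s\<close> for some integer
  \<open>m\<close>, so counting from it merely translates the integers.\<close>

lemma orbit_eq_range_pin:
  assumes "\<omega> \<in> orbits"
  shows "\<omega> = range (\<lambda>n. torus_point L (pin \<omega> n))"
proof -
  obtain t where t: "\<omega> = tau_orbit L s t"
    using assms unfolding tau_orbits_def by blast
  have "torus_point L (\<alpha> \<omega>) \<in> \<omega>"
    using pinning assms unfolding tau_pinning_def by blast
  then obtain m where "torus_point L (\<alpha> \<omega>) = torus_point L (t + of_int m * s)"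
    unfolding t tau_orbit_def by blast
  then have m: "\<alpha> \<omega> - (t + of_int m * s) \<in> L"
    by (simp add: torus_point_eq_iff)
  have "torus_point L (pin \<omega> n) = torus_point L (t + of_int (n + m) * s)" for n
    using m by (simp add: torus_point_eq_iff pin_def algebra_simps)
  then have "range (\<lambda>n. torus_point L (pin \<omega> n)) = range (\<lambda>n. torus_point L (t + of_int (n + m) * s))"
    by simp
  also have "\<dots> = range ((\<lambda>n. torus_point L (t + of_int n * s)) \<circ> (\<lambda>n. n + m))"
    by (simp add: o_def)
  also have "\<dots> = range (\<lambda>n. torus_point L (t + of_int n * s))"
    unfolding image_comp [symmetric] by simp
  finally show ?thesis
    using t by (simp add: tau_orbit_def)
qed

text \<open>Congruent points lie on the same orbit, and non-torsion then equates the integers. With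
  \<open>pin_surj\<close>, pairs of an orbit and an integer enumerate the torus without
  repetition.\<close>

lemma pin_inj:
  assumes "\<omega> \<in> orbits" "\<omega>' \<in> orbits" "pin \<omega> n - pin \<omega>' n' \<in> L"
  shows "\<omega> = \<omega>' \<and> n = n'"
proof -
  have *: "torus_point L (pin \<omega> m) = torus_point L (pin \<omega>' (m - n + n'))" for m
    using assms(3) by (simp add: torus_point_eq_iff pin_def algebra_simps)
  have "range (\<lambda>m. torus_point L (pin \<omega> m)) = range ((\<lambda>m. torus_point L (pin \<omega>' m)) \<circ> (\<lambda>m. m - n + n'))"
    by (simp add: o_def *)
  also have "\<dots> = range (\<lambda>m. torus_point L (pin \<omega>' m))"
    unfolding image_comp [symmetric]
    by (rule arg_cong[of _ _ "image _"]) (rule surjI[of _ "\<lambda>m. m + n - n'"], simp)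
  finally have eq: "\<omega> = \<omega>'"
    using orbit_eq_range_pin assms(1,2) by metis
  have "of_int (n - n') * s \<in> L"
    using assms(3) by (simp add: eq pin_def algebra_simps)
  then have "n - n' = 0"
    unfolding multiple_in_lattice_iff .
  with eq show ?thesis by simp
qed

lemma pin_surj: obtains \<omega> n where "\<omega> \<in> orbits" "a - pin \<omega> n \<in> L"
proof -
  define \<omega> where "\<omega> = tau_orbit L s a"
  have \<omega>: "\<omega> \<in> orbits"
    by (simp add: \<omega>_def tau_orbits_def)
  have "torus_point L (a + of_int 0 * s) \<in> \<omega>"
    unfolding \<omega>_def tau_orbit_def by (rule rangeI)
  then obtain n where "torus_point L a = torus_point L (pin \<omega> n)"
    using orbit_eq_range_pin[OF \<omega>] by auto
  then show ?thesis
    using that \<omega> by (simp add: torus_point_eq_iff)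
qed

lemma polar_coeff_lattice_translate:
  assumes "f meromorphic_on UNIV" "\<forall>z. \<forall>a\<in>L. f (z + a) = f z" "b - a \<in> L"
  shows "polar_coeff k f b = polar_coeff k f a"
  using polar_coeff_translate[OF assms(1), of k "b - a" a] assms(2,3) by simp

text \<open>Periodicity makes the chosen representative of a torus point immaterial, and
  \<open>pin_inj\<close> allows the points of the orbit to be indexed by integers.\<close>

lemma Ores_eq_infsum:
  assumes "f meromorphic_on UNIV" "\<forall>z. \<forall>a\<in>L. f (z + a) = f z" "\<omega> \<in> orbits"
  shows "Ores f \<omega> k = (\<Sum>\<^sub>\<infinity>n\<in>UNIV. polar_coeff k f (pin \<omega> n))"
proof -
  have torus: "torus_polar_coeff k f (torus_point L a) = polar_coeff k f a" for a
  proof -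
    have "a \<in> torus_point L a"
      unfolding torus_point_def by (intro image_eqI[of _ _ 0]) auto
    then have "(SOME b. b \<in> torus_point L a) \<in> torus_point L a"
      by (rule someI)
    then have "(SOME b. b \<in> torus_point L a) - a \<in> L"
      by (auto simp: torus_point_def)
    then show ?thesis
      unfolding torus_polar_coeff_def by (rule polar_coeff_lattice_translate[OF assms(1,2)])
  qed
  have "inj (\<lambda>n. torus_point L (pin \<omega> n))"
    by (rule injI) (use pin_inj[OF assms(3,3)] in \<open>auto simp: torus_point_eq_iff\<close>)
  then have "(\<Sum>\<^sub>\<infinity>p\<in>range (\<lambda>n. torus_point L (pin \<omega> n)). torus_polar_coeff k f p) =
      (\<Sum>\<^sub>\<infinity>n\<in>UNIV. polar_coeff k f (pin \<omega> n))"
    by (subst infsum_reindex) (auto simp: o_def torus)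
  then show ?thesis
    unfolding Ores_def using orbit_eq_range_pin[OF assms(3)] by simp
qed

text \<open>
  The polar coefficients of \<open>f\<close> are supported in a finite box. The bound on \<open>n\<close> is strict so
  that shifting by one step along an orbit stays within \<open>{- M..M}\<close>.
\<close>

definition polar_support ::
    "(complex \<Rightarrow> complex) \<Rightarrow> complex set set set \<Rightarrow> int \<Rightarrow> nat \<Rightarrow> bool" where
  "polar_support f A M N \<longleftrightarrow> finite A \<and> A \<subseteq> orbits \<and> N \<ge> 1 \<and>
     (\<forall>\<omega>\<in>orbits. \<forall>n. \<forall>k\<ge>1. polar_coeff k f (pin \<omega> n) \<noteq> 0 \<longrightarrow> \<omega> \<in> A \<and> \<bar>n\<bar> < M \<and> k \<le> N)"

lemma polar_supportD:
  assumes "polar_support f A M N"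
  shows "finite A" "A \<subseteq> orbits" "N \<ge> 1"
    and "\<And>\<omega> n k. \<omega> \<in> orbits \<Longrightarrow> k \<ge> 1 \<Longrightarrow> \<omega> \<notin> A \<Longrightarrow> polar_coeff k f (pin \<omega> n) = 0"
    and "\<And>\<omega> n k. \<omega> \<in> orbits \<Longrightarrow> k \<ge> 1 \<Longrightarrow> M \<le> \<bar>n\<bar> \<Longrightarrow> polar_coeff k f (pin \<omega> n) = 0"
    and "\<And>\<omega> n k. \<omega> \<in> orbits \<Longrightarrow> k \<ge> 1 \<Longrightarrow> N < k \<Longrightarrow> polar_coeff k f (pin \<omega> n) = 0"
    and "\<And>\<omega> n k. \<omega> \<in> orbits \<Longrightarrow> k \<ge> 1 \<Longrightarrow> n \<notin> {- M..M} \<Longrightarrow> polar_coeff k f (pin \<omega> n) = 0"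
proof -
  have *: "\<omega> \<in> A \<and> \<bar>n\<bar> < M \<and> k \<le> N" if "\<omega> \<in> orbits" "k \<ge> 1" "polar_coeff k f (pin \<omega> n) \<noteq> 0" for \<omega> n k
    using assms that unfolding polar_support_def by blast
  show "polar_coeff k f (pin \<omega> n) = 0" if "\<omega> \<in> orbits" "k \<ge> 1" "\<omega> \<notin> A" for \<omega> n k
    using *[OF that(1,2)] that(3) by blast
  show "polar_coeff k f (pin \<omega> n) = 0" if "\<omega> \<in> orbits" "k \<ge> 1" "M \<le> \<bar>n\<bar>" for \<omega> n k
    using *[OF that(1,2), of n] that(3) by linarith
  show "polar_coeff k f (pin \<omega> n) = 0" if "\<omega> \<in> orbits" "k \<ge> 1" "N < k" for \<omega> n k
    using *[OF that(1,2), of n] that(3) by linarith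
  show "polar_coeff k f (pin \<omega> n) = 0" if "\<omega> \<in> orbits" "k \<ge> 1" "n \<notin> {- M..M}" for \<omega> n k
    using *[OF that(1,2), of n] that(3) by fastforce
qed (use assms in \<open>auto simp: polar_support_def\<close>)

text \<open>Every pole can be moved by a period into a compact disc, which contains finitely many
  singularities. Each of these lies on one orbit, at one integer, and has finite order.\<close>

lemma polar_support_exists:
  assumes mero: "f meromorphic_on UNIV" and per: "\<forall>z. \<forall>a\<in>L. f (z + a) = f z"
  obtains A M N where "polar_support f A M N"
proof -
  define C where "C = cball (0 :: complex) (cmod w1 + cmod w2)"
  define P where "P = {z \<in> C. \<not> f analytic_on {z}}"
  have "{z. \<not> f analytic_on {z}} sparse_in C"
    using meromorphic_on_imp_sparse_singularities[OF mero] by (rule sparse_in_subset) auto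
  then have "finite (C \<inter> {z. \<not> f analytic_on {z}})"
    by (rule sparse_in_compact_finite) (simp add: C_def)
  then have finP: "finite P"
    by (simp add: P_def Int_def)
  have "\<forall>p. \<exists>\<omega> n K. \<omega> \<in> orbits \<and> p - pin \<omega> n \<in> L \<and> (\<forall>k\<ge>K. polar_coeff k f p = 0)"
    using pin_surj polar_coeff_large_eq_0 by metis
  then obtain W n K where WnK: "\<And>p. W p \<in> orbits" "\<And>p. p - pin (W p) (n p) \<in> L"
    "\<And>p k. K p \<le> k \<Longrightarrow> polar_coeff k f p = 0"
    by metis
  \<comment> \<open>\<open>insert\<close> covers an empty \<open>P\<close>, and adding 1 makes the
    bound strict.\<close>
  define M where "M = Max (insert 0 ((\<lambda>p. \<bar>n p\<bar>) ` P)) + 1"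
  define N where "N = Max (insert 1 (K ` P))"
  have M: "\<bar>n p\<bar> < M" if "p \<in> P" for p
  proof -
    have "\<bar>n p\<bar> \<le> Max (insert 0 ((\<lambda>p. \<bar>n p\<bar>) ` P))"
      using finP that by (intro Max_ge) auto
    then show ?thesis by (simp add: M_def)
  qed
  have N: "K p \<le> N" if "p \<in> P" for p
    unfolding N_def using finP that by (intro Max_ge) auto
  have "N \<ge> 1"
    unfolding N_def using finP by (intro Max_ge) auto
  have "\<omega> \<in> W ` P \<and> \<bar>m\<bar> < M \<and> k \<le> N"
    if \<omega>: "\<omega> \<in> orbits" and k: "k \<ge> 1" and nz: "polar_coeff k f (pin \<omega> m) \<noteq> 0" for \<omega> m k
  proof -
    obtain l where l: "l \<in> L" "pin \<omega> m + l \<in> C"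
      using translate_into_compact unfolding C_def by blast
    define p where "p = pin \<omega> m + l"
    have "polar_coeff k f p = polar_coeff k f (pin \<omega> m)"
      by (rule polar_coeff_lattice_translate[OF mero per]) (auto simp: p_def l)
    then have nzp: "polar_coeff k f p \<noteq> 0"
      using nz by simp
    then have p: "p \<in> P"
      using polar_coeff_analytic[OF _ k] l by (auto simp: P_def p_def)
    have "p - pin (W p) (n p) - l \<in> L"
      by (rule lattice_diff[OF WnK(2) l(1)])
    moreover have "p - pin (W p) (n p) - l = pin \<omega> m - pin (W p) (n p)"
      by (simp add: p_def)
    ultimately have "\<omega> = W p \<and> m = n p"
      using pin_inj[OF \<omega> WnK(1)] by simp
    moreover have "k < K p"
      using WnK(3)[of p k] nzp by force
    ultimately show ?thesis
      using p M N by fastforce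
  qed
  then have "polar_support f (W ` P) M N"
    unfolding polar_support_def using finP WnK(1) \<open>N \<ge> 1\<close> by auto
  then show ?thesis
    by (rule that)
qed

section \<open>Zeta combinations over a box of pins, and the residues as finite sums\<close>

definition pin_sum ::
    "complex set set set \<Rightarrow> int \<Rightarrow> nat \<Rightarrow> (complex set set \<Rightarrow> int \<Rightarrow> nat \<Rightarrow> complex) \<Rightarrow> complex \<Rightarrow> complex" where
  "pin_sum A M N d = zeta_sum (A \<times> {- M..M}) N (\<lambda>(\<omega>, n). pin \<omega> n) (\<lambda>(\<omega>, n). d \<omega> n)"

lemma pin_sum_altdef:
  "pin_sum A M N d z = (\<Sum>\<omega>\<in>A. \<Sum>n=-M..M. \<Sum>k=1..N. d \<omega> n k * zeta_basis k (z - pin \<omega> n))"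
  unfolding pin_sum_def zeta_sum_def by (subst sum.cartesian_product) (intro sum.cong, auto)

lemma pin_sum_swap:
  "pin_sum A M N d z = (\<Sum>\<omega>\<in>A. \<Sum>k=1..N. \<Sum>n=-M..M. d \<omega> n k * zeta_basis k (z - pin \<omega> n))"
  unfolding pin_sum_altdef by (intro sum.cong refl sum.swap)

lemma pin_sum_cong:
  "(\<And>\<omega> n k. \<omega> \<in> A \<Longrightarrow> k \<ge> 1 \<Longrightarrow> d \<omega> n k = d' \<omega> n k) \<Longrightarrow> pin_sum A M N d z = pin_sum A M N d' z"
  unfolding pin_sum_altdef by (intro sum.cong refl) auto

lemma pin_sum_diff:
  "pin_sum A M N (\<lambda>\<omega> n k. d \<omega> n k - d' \<omega> n k) z = pin_sum A M N d z - pin_sum A M N d' z"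
  unfolding pin_sum_altdef by (simp add: algebra_simps sum_subtractf)

text \<open>Translating the argument by \<open>s\<close> moves the pole at
  \<open>pin \<omega> n\<close> to \<open>pin \<omega> (n - 1)\<close>, so it acts on coefficients
  as the shift \<open>n -> n + 1\<close>. Vanishing at the ends keeps the result in the box.\<close>

lemma pin_sum_shift:
  assumes "\<And>\<omega> n k. \<omega> \<in> A \<Longrightarrow> k \<ge> 1 \<Longrightarrow> M \<le> \<bar>n\<bar> \<Longrightarrow> d \<omega> n k = 0"
  shows "pin_sum A M N d (z + s) = pin_sum A M N (\<lambda>\<omega> n k. d \<omega> (n + 1) k) z"
proof -
  have "(\<Sum>n=-M..M. d \<omega> (n + 1) k * zeta_basis k (z - pin \<omega> n)) =
      (\<Sum>n=-M..M. d \<omega> n k * zeta_basis k (z + s - pin \<omega> n))" if "\<omega> \<in> A" "k \<in> {1..N}" for \<omega> k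
  proof -
    have eq: "z - pin \<omega> (n - 1) = z + s - pin \<omega> n" for n
      by (simp add: pin_def algebra_simps)
    have "(\<Sum>n=-M..M. d \<omega> (n + 1) k * zeta_basis k (z - pin \<omega> n)) =
        (\<Sum>n=-M..M. d \<omega> n k * zeta_basis k (z - pin \<omega> (n - 1)))"
      using that assms
      by (intro sum_shift_finite_support[where u = "\<lambda>n. d \<omega> n k" and v = "\<lambda>n. zeta_basis k (z - pin \<omega> n)"]) auto
    then show ?thesis
      unfolding eq .
  qed
  then have "(\<Sum>k=1..N. \<Sum>n=-M..M. d \<omega> (n + 1) k * zeta_basis k (z - pin \<omega> n)) =
      (\<Sum>k=1..N. \<Sum>n=-M..M. d \<omega> n k * zeta_basis k (z + s - pin \<omega> n))" if "\<omega> \<in> A" for \<omega>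
    using that by (intro sum.cong[OF refl, of "{1..N}"])
  then show ?thesis
    unfolding pin_sum_swap by simp
qed

lemma zeta_part_eq_pin_sum:
  assumes "polar_support f A M N"
  shows "zeta_part L s \<alpha> f z = pin_sum A M N (\<lambda>\<omega> n k. polar_coeff k f (pin \<omega> n)) z"
proof -
  note supp = polar_supportD[OF assms]
  let ?F = "\<lambda>\<omega> n k. polar_coeff k f (pin \<omega> n) * zeta_basis k (z - pin \<omega> n)"
  have "zeta_part L s \<alpha> f z = (\<Sum>\<^sub>\<infinity>\<omega>\<in>orbits. \<Sum>\<^sub>\<infinity>n\<in>UNIV. \<Sum>\<^sub>\<infinity>k\<in>{1..}. ?F \<omega> n k)"
    unfolding zeta_part_def zeta_basis_def pin_def by (simp add: algebra_simps)
  also have "\<dots> = (\<Sum>\<^sub>\<infinity>\<omega>\<in>orbits. \<Sum>\<^sub>\<infinity>n\<in>UNIV. \<Sum>k=1..N. ?F \<omega> n k)"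
    by (intro infsum_cong infsum_eq_sum) (auto simp: supp(6))
  also have "\<dots> = (\<Sum>\<^sub>\<infinity>\<omega>\<in>orbits. \<Sum>n=-M..M. \<Sum>k=1..N. ?F \<omega> n k)"
    by (intro infsum_cong infsum_eq_sum sum.neutral ballI) (auto simp: supp(7))
  also have "\<dots> = (\<Sum>\<omega>\<in>A. \<Sum>n=-M..M. \<Sum>k=1..N. ?F \<omega> n k)"
    using supp(1,2) by (intro infsum_eq_sum sum.neutral ballI) (auto simp: supp(4))
  finally show ?thesis
    by (simp add: pin_sum_altdef)
qed

lemma PanOres1_eq_sum:
  assumes "polar_support f A M N"
  shows "PanOres1 L s \<alpha> f = (\<Sum>\<omega>\<in>A. \<Sum>n=-M..M. of_int n * polar_coeff 1 f (pin \<omega> n))"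
proof -
  note supp = polar_supportD[OF assms]
  have "PanOres1 L s \<alpha> f = (\<Sum>\<^sub>\<infinity>\<omega>\<in>orbits. \<Sum>\<^sub>\<infinity>n\<in>UNIV. of_int n * polar_coeff 1 f (pin \<omega> n))"
    unfolding PanOres1_def pin_def by simp
  also have "\<dots> = (\<Sum>\<^sub>\<infinity>\<omega>\<in>orbits. \<Sum>n=-M..M. of_int n * polar_coeff 1 f (pin \<omega> n))"
    by (intro infsum_cong infsum_eq_sum) (auto simp: supp(7))
  also have "\<dots> = (\<Sum>\<omega>\<in>A. \<Sum>n=-M..M. of_int n * polar_coeff 1 f (pin \<omega> n))"
    using supp(1,2) by (intro infsum_eq_sum sum.neutral ballI) (auto simp: supp(4))
  finally show ?thesis .
qed

lemma Ores_eq_sum: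
  assumes "f meromorphic_on UNIV" "\<forall>z. \<forall>a\<in>L. f (z + a) = f z"
    and "polar_support f A M N" "\<omega> \<in> orbits" "k \<ge> 1"
  shows "Ores f \<omega> k = (\<Sum>n=-M..M. polar_coeff k f (pin \<omega> n))"
  unfolding Ores_eq_infsum[OF assms(1,2,4)]
  by (intro infsum_eq_sum) (auto simp: polar_supportD(7)[OF assms(3,4,5)])

text \<open>The definite description asks for uniqueness: two such constants agree at some point of
  a punctured neighbourhood of 0.\<close>

lemma c0_eqI:
  assumes "\<And>x. eventually (\<lambda>z. f z = b + zeta_part L s \<alpha> f z) (at x)"
  shows "c0 L s \<alpha> f = b"
  unfolding c0_def
proof (rule the_equality)
  show "\<forall>\<^sub>\<approx>z\<in>UNIV. f z = b + zeta_part L s \<alpha> f z"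
    using assms by (simp add: eventually_cosparse_open_eq)
  fix c assume "\<forall>\<^sub>\<approx>z\<in>UNIV. f z = c + zeta_part L s \<alpha> f z"
  then have "eventually (\<lambda>z. f z = c + zeta_part L s \<alpha> f z) (at 0)"
    by (simp add: eventually_cosparse_open_eq)
  with assms[of 0] have "eventually (\<lambda>z :: complex. c = b) (at 0)"
    by eventually_elim simp
  then show "c = b" by simp
qed

text \<open>The pins in the box represent every pole exactly once modulo the lattice, so
  \<open>elliptic_zeta_expansion\<close> applies; its constant is then identified with
  \<open>c0\<close>.\<close>

lemma elliptic_expansion:
  assumes mero: "f meromorphic_on UNIV" and per: "\<forall>z. \<forall>a\<in>L. f (z + a) = f z"
    and supp: "polar_support f A M N"
  shows "(\<Sum>\<omega>\<in>A. \<Sum>n=-M..M. polar_coeff 1 f (pin \<omega> n)) = 0"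
    and "eventually (\<lambda>z. f z = c0 L s \<alpha> f + pin_sum A M N (\<lambda>\<omega> n k. polar_coeff k f (pin \<omega> n)) z) (at x)"
proof -
  note suppD = polar_supportD[OF supp]
  let ?I = "A \<times> {- M..M}" and ?\<beta> = "\<lambda>(\<omega>, n). pin \<omega> n"
  have fin: "finite ?I"
    using suppD(1) by simp
  have inj: "i = j" if "i \<in> ?I" "j \<in> ?I" "?\<beta> i - ?\<beta> j \<in> L" for i j
  proof -
    have "fst i \<in> orbits" "fst j \<in> orbits"
      using that suppD(2) by auto
    then show ?thesis
      using that(3) pin_inj by (simp add: prod_eq_iff case_prod_unfold)
  qed
  have poles: "k \<le> N \<and> (\<exists>i\<in>?I. a - ?\<beta> i \<in> L)" if k: "k \<ge> 1" and nz: "polar_coeff k f a \<noteq> 0" for a k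
  proof -
    obtain \<omega> n where \<omega>: "\<omega> \<in> orbits" "a - pin \<omega> n \<in> L"
      using pin_surj .
    then have "polar_coeff k f (pin \<omega> n) \<noteq> 0"
      using polar_coeff_lattice_translate[OF mero per \<omega>(2)] nz by simp
    then have "\<omega> \<in> A" "\<bar>n\<bar> < M" "k \<le> N"
      using supp \<omega>(1) k unfolding polar_support_def by blast+
    then show ?thesis
      using \<omega>(2) by (intro conjI bexI[of _ "(\<omega>, n)"]) auto
  qed
  have "(\<Sum>i\<in>?I. polar_coeff 1 f (?\<beta> i)) = 0"
    by (rule elliptic_zeta_expansion(1)[OF mero per fin suppD(3)]) (rule inj poles; assumption)+
  then show "(\<Sum>\<omega>\<in>A. \<Sum>n=-M..M. polar_coeff 1 f (pin \<omega> n)) = 0"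
    by (subst sum.cartesian_product) (simp add: case_prod_unfold)
  have "\<exists>b. \<forall>x. eventually (\<lambda>z. f z = b + zeta_sum ?I N ?\<beta> (\<lambda>i k. polar_coeff k f (?\<beta> i)) z) (at x)"
    by (rule elliptic_zeta_expansion(2)[OF mero per fin suppD(3)]) (rule inj poles; assumption)+
  then obtain b where b: "\<And>x. eventually (\<lambda>z. f z = b + zeta_sum ?I N ?\<beta> (\<lambda>i k. polar_coeff k f (?\<beta> i)) z) (at x)"
    by blast
  have "zeta_sum ?I N ?\<beta> (\<lambda>i k. polar_coeff k f (?\<beta> i)) = pin_sum A M N (\<lambda>\<omega> n k. polar_coeff k f (pin \<omega> n))"
    unfolding pin_sum_def by (simp add: case_prod_unfold)
  then have ev: "eventually (\<lambda>z. f z = b + pin_sum A M N (\<lambda>\<omega> n k. polar_coeff k f (pin \<omega> n)) z) (at x)" for x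
    using b[of x] by simp
  then have "c0 L s \<alpha> f = b"
    by (intro c0_eqI) (simp add: zeta_part_eq_pin_sum[OF supp])
  then show "eventually (\<lambda>z. f z = c0 L s \<alpha> f + pin_sum A M N (\<lambda>\<omega> n k. polar_coeff k f (pin \<omega> n)) z) (at x)"
    using ev by simp
qed

section \<open>Summable functions have vanishing residues\<close>

lemma elliptic_fieldD:
  assumes "f \<in> elliptic_field L"
  shows "f nicely_meromorphic_on UNIV" "f meromorphic_on UNIV" "\<forall>z. \<forall>a\<in>L. f (z + a) = f z"
  using assms by (auto simp: elliptic_field_def nicely_meromorphic_on_def)

lemma residues_vanish_if_summable:
  assumes f: "f \<in> elliptic_field L" and "elliptically_summable L s f"
  shows "PanOres0 L s \<alpha> f = 0" "PanOres1 L s \<alpha> f = 0"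
    and "\<And>\<omega> k. \<omega> \<in> orbits \<Longrightarrow> k \<ge> 1 \<Longrightarrow> Ores f \<omega> k = 0"
proof -
  obtain g where g: "g \<in> elliptic_field L" and fg: "f = remove_sings (\<lambda>z. g (z + s) - g z)"
    using assms(2) unfolding elliptically_summable_def shift_op_def by blast
  note gD = elliptic_fieldD[OF g] and fD = elliptic_fieldD[OF f]
  have mero_diff: "(\<lambda>z. g (z + s) - g z) meromorphic_on UNIV"
    by (intro meromorphic_intros meromorphic_on_translate gD)
  have ev: "eventually (\<lambda>z. f z = g (z + s) - g z) (at x)" for x
    unfolding fg using mero_diff by (intro eventually_remove_sings_eq_at) (auto simp: meromorphic_on_altdef)
  have coeff: "polar_coeff k f (pin \<omega> n) = polar_coeff k g (pin \<omega> (n + 1)) - polar_coeff k g (pin \<omega> n)" for k \<omega> n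
  proof -
    have "polar_coeff k f (pin \<omega> n) = polar_coeff k (\<lambda>z. g (z + s) - g z) (pin \<omega> n)"
      by (rule polar_coeff_cong[OF ev])
    also have "\<dots> = polar_coeff k g (pin \<omega> n + s) - polar_coeff k g (pin \<omega> n)"
      by (subst polar_coeff_diff) (auto intro!: meromorphic_on_translate gD simp: polar_coeff_translate gD)
    also have "pin \<omega> n + s = pin \<omega> (n + 1)"
      by (simp add: pin_def algebra_simps)
    finally show ?thesis .
  qed
  obtain A M' N where g': "polar_support g A M' N"
    using polar_support_exists[OF gD(2,3)] by blast
  \<comment> \<open>The coefficient of \<open>f\<close> at \<open>n\<close> involves that of
    \<open>g\<close> at \<open>n + 1\<close>, so the support can grow by one step; the wider box
    serves both functions.\<close>
  define M where "M = M' + 1"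
  have gs: "polar_support g A M N"
    using g' unfolding polar_support_def M_def by fastforce
  have fs: "polar_support f A M N"
    unfolding polar_support_def
  proof (intro conjI ballI allI impI)
    fix \<omega> n and k :: nat
    assume \<omega>: "\<omega> \<in> orbits" "1 \<le> k" "polar_coeff k f (pin \<omega> n) \<noteq> 0"
    then consider "polar_coeff k g (pin \<omega> (n + 1)) \<noteq> 0" | "polar_coeff k g (pin \<omega> n) \<noteq> 0"
      unfolding coeff by fastforce
    then have "\<omega> \<in> A \<and> \<bar>n\<bar> < M \<and> k \<le> N"
    proof cases
      case 1
      then have "\<omega> \<in> A" "\<bar>n + 1\<bar> < M'" "k \<le> N"
        using g' \<omega> unfolding polar_support_def by blast+
      then show ?thesis by (auto simp: M_def)
    next
      case 2
      then show ?thesis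
        using gs \<omega> unfolding polar_support_def by blast
    qed
    then show "\<omega> \<in> A" "\<bar>n\<bar> < M" "k \<le> N" by auto
  qed (use polar_supportD[OF gs] in auto)
  have g0: "polar_coeff k g (pin \<omega> n) = 0" if "\<omega> \<in> orbits" "k \<ge> 1" "M \<le> \<bar>n\<bar>" for k \<omega> n
    using polar_supportD(5)[OF gs] that by blast
  have AO: "\<omega> \<in> orbits" if "\<omega> \<in> A" for \<omega>
    using polar_supportD(2)[OF gs] that by blast
  show "Ores f \<omega> k = 0" if "\<omega> \<in> orbits" "k \<ge> 1" for \<omega> k
  proof -
    have "Ores f \<omega> k = (\<Sum>n=-M..M. (polar_coeff k g (pin \<omega> (n + 1)) - polar_coeff k g (pin \<omega> n)) * 1)"
      using Ores_eq_sum[OF fD(2,3) fs that] by (simp add: coeff)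
    also have "\<dots> = 0"
      by (subst sum_by_parts_finite_support[where u = "\<lambda>n. polar_coeff k g (pin \<omega> n)"])
        (simp_all only: g0[OF that], simp)
    finally show ?thesis .
  qed
  \<comment> \<open>By parts, the weight \<open>n\<close> contributes the difference -1 and leaves
    the residues of \<open>g\<close> on this orbit. Their total over all orbits vanishes by
    \<open>elliptic_expansion\<close>.\<close>
  have "(\<Sum>n=-M..M. of_int n * polar_coeff 1 f (pin \<omega> n)) = - (\<Sum>n=-M..M. polar_coeff 1 g (pin \<omega> n))"
    if "\<omega> \<in> A" for \<omega>
  proof -
    have "(\<Sum>n=-M..M. of_int n * polar_coeff 1 f (pin \<omega> n)) =
        (\<Sum>n=-M..M. (polar_coeff 1 g (pin \<omega> (n + 1)) - polar_coeff 1 g (pin \<omega> n)) * of_int n)"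
      by (simp add: coeff mult.commute)
    also have "\<dots> = (\<Sum>n=-M..M. polar_coeff 1 g (pin \<omega> n) * (of_int (n - 1) - of_int n))"
      by (intro sum_by_parts_finite_support[where u = "\<lambda>n. polar_coeff 1 g (pin \<omega> n)"])
        (simp add: g0 AO[OF that])
    finally show ?thesis
      by (simp add: sum_negf)
  qed
  then show "PanOres1 L s \<alpha> f = 0"
    unfolding PanOres1_eq_sum[OF fs] using elliptic_expansion(1)[OF gD(2,3) gs] by (simp add: sum_negf)
  show "PanOres0 L s \<alpha> f = 0"
    unfolding PanOres0_def
  proof (rule c0_eqI)
    fix x
    let ?d = "\<lambda>\<omega> n k. polar_coeff k g (pin \<omega> n)"
    have exp: "eventually (\<lambda>z. g z = c0 L s \<alpha> g + pin_sum A M N ?d z) (at y)" for y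
      by (rule elliptic_expansion(2)[OF gD(2,3) gs])
    \<comment> \<open>The expansions at \<open>z\<close> and \<open>z + s\<close> carry the same
      constant, which cancels in the difference.\<close>
    have "eventually (\<lambda>z. g (z + s) = c0 L s \<alpha> g + pin_sum A M N ?d (z + s)) (at x)"
      by (subst eventually_at_translate) (rule exp)
    with exp[of x] ev[of x]
    show "eventually (\<lambda>z. f z = 0 + zeta_part L s \<alpha> f z) (at x)"
    proof eventually_elim
      case (elim z)
      have "pin_sum A M N ?d (z + s) = pin_sum A M N (\<lambda>\<omega> n k. ?d \<omega> (n + 1) k) z"
        using g0 AO by (intro pin_sum_shift) auto
      then have "f z = pin_sum A M N (\<lambda>\<omega> n k. ?d \<omega> (n + 1) k - ?d \<omega> n k) z"
        using elim unfolding pin_sum_diff by simp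
      then show ?case
        by (simp add: zeta_part_eq_pin_sum[OF fs] coeff)
    qed
  qed
qed

section \<open>Construction of a primitive from vanishing residues\<close>

lemma summable_if_residues_vanish:
  assumes f: "f \<in> elliptic_field L" and P0: "PanOres0 L s \<alpha> f = 0" and P1: "PanOres1 L s \<alpha> f = 0"
    and O: "\<And>\<omega> k. \<omega> \<in> orbits \<Longrightarrow> k \<ge> 1 \<Longrightarrow> Ores f \<omega> k = 0"
  shows "elliptically_summable L s f"
proof -
  note fD = elliptic_fieldD[OF f]
  obtain A M N where fs: "polar_support f A M N"
    using polar_support_exists[OF fD(2,3)] by blast
  note suppD = polar_supportD[OF fs]
  define c where "c = (\<lambda>\<omega> n k. polar_coeff k f (pin \<omega> n))"
  \<comment> \<open>The discrete primitive that vanishes on the far left. Stopping at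
    \<open>n - 1\<close> makes \<open>c\<close> its forward difference, matching the shift in
    \<open>pin_sum_shift\<close>.\<close>
  define d where "d = (\<lambda>\<omega> n k. \<Sum>m=-M..n-1. c \<omega> m k)"
  have c0: "c \<omega> n k = 0" if "\<omega> \<in> A" "k \<ge> 1" "M \<le> \<bar>n\<bar>" for \<omega> n k
    using suppD(2,5) that unfolding c_def by blast
  have d_step: "d \<omega> (n + 1) k - d \<omega> n k = c \<omega> n k" if "\<omega> \<in> A" "k \<ge> 1" for \<omega> n k
  proof (cases "- M \<le> n")
    case True
    then have "{- M..n} = insert n {- M..n - 1}" by auto
    then show ?thesis by (simp add: d_def)
  next
    case False
    then show ?thesis
      using c0[OF that, of n] by (simp add: d_def)
  qed
  \<comment> \<open>On the left the sum is empty. From \<open>n = M\<close> on it has collected the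
    whole support and equals the orbital residue, so the vanishing of that residue keeps
    \<open>d\<close> finitely supported.\<close>
  have d0: "d \<omega> n k = 0" if "\<omega> \<in> A" "k \<ge> 1" "M \<le> \<bar>n\<bar>" for \<omega> n k
  proof (cases "n \<le> - M")
    case True
    then show ?thesis by (simp add: d_def)
  next
    case False
    then have "M \<le> n" using that(3) by linarith
    have "d \<omega> n k = (\<Sum>m\<in>{-M..M} \<inter> {-M..n-1}. c \<omega> m k)"
      unfolding d_def using c0[OF that(1,2)] by (intro sum.mono_neutral_right) auto
    also have "\<dots> = (\<Sum>m=-M..M. c \<omega> m k)"
      using c0[OF that(1,2)] \<open>M \<le> n\<close> by (intro sum.mono_neutral_left) auto
    also have "\<dots> = Ores f \<omega> k"
      unfolding c_def using that suppD(2) by (intro Ores_eq_sum[OF fD(2,3) fs, symmetric]) auto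
    finally show ?thesis
      using O that suppD(2) by auto
  qed
  define G where "G = pin_sum A M N d"
  have G_mero: "G meromorphic_on UNIV"
    unfolding G_def pin_sum_def by (rule zeta_sum_meromorphic)
  have G_diff: "G (z + s) - G z = pin_sum A M N c z" for z
  proof -
    have "G (z + s) - G z = pin_sum A M N (\<lambda>\<omega> n k. d \<omega> (n + 1) k - d \<omega> n k) z"
      unfolding G_def pin_sum_diff using d0 by (subst pin_sum_shift) auto
    also have "\<dots> = pin_sum A M N c z"
      by (rule pin_sum_cong) (rule d_step)
    finally show ?thesis .
  qed
  have f_ev: "eventually (\<lambda>z. f z = G (z + s) - G z) (at x)" for x
    using elliptic_expansion(2)[OF fD(2,3) fs, of x] P0 by (simp add: PanOres0_def G_diff c_def)
  have "(\<Sum>n=-M..M. of_int n * c \<omega> n 1) = - (\<Sum>n=-M..M. d \<omega> n 1)" if "\<omega> \<in> A" for \<omega>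
  proof -
    have "(\<Sum>n=-M..M. of_int n * c \<omega> n 1) = (\<Sum>n=-M..M. (d \<omega> (n + 1) 1 - d \<omega> n 1) * of_int n)"
      using that by (simp add: d_step mult.commute)
    also have "\<dots> = (\<Sum>n=-M..M. d \<omega> n 1 * (of_int (n - 1) - of_int n))"
      by (intro sum_by_parts_finite_support[where u = "\<lambda>n. d \<omega> n 1"]) (simp add: d0 that)
    finally show ?thesis
      by (simp add: sum_negf)
  qed
  \<comment> \<open>This is the condition under which the quasi-period term in
    \<open>zeta_sum_translate\<close> disappears, so here the first panorbital residue secures the
    periodicity of \<open>G\<close>.\<close>
  then have d_sum: "(\<Sum>\<omega>\<in>A. \<Sum>n=-M..M. d \<omega> n 1) = 0"
    using P1 unfolding PanOres1_eq_sum[OF fs] by (simp add: c_def sum_negf)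
  have G_per: "eventually (\<lambda>z. G (z + a) = G z) (at x)" if "a \<in> L" for a x
  proof -
    have fin: "finite (A \<times> {- M..M})"
      using suppD(1) by simp
    have "(\<Sum>i\<in>A \<times> {- M..M}. (case i of (\<omega>, n) \<Rightarrow> d \<omega> n) 1) = 0"
      using d_sum by (subst (asm) sum.cartesian_product) (simp add: case_prod_unfold)
    then show ?thesis
      using eventually_zeta_sum_translate[OF fin that suppD(3), of "\<lambda>(\<omega>, n). pin \<omega> n" "\<lambda>(\<omega>, n). d \<omega> n" x]
      unfolding G_def pin_sum_def by simp
  qed
  \<comment> \<open>\<open>G\<close> is known to be periodic only near each point, with the point
    excluded; removing singularities yields a representative that is periodic everywhere.\<close>
  define g where "g = remove_sings G"
  have "g \<in> elliptic_field L"
    unfolding elliptic_field_def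
  proof (intro CollectI conjI allI ballI)
    show "g nicely_meromorphic_on UNIV"
      unfolding g_def by (rule remove_sings_nicely_meromorphic[OF G_mero])
    show "g (z + a) = g z" if "a \<in> L" for z a
      using remove_sings_cong[OF G_per[OF that, of z] refl] by (simp add: g_def remove_sings_translate)
  qed
  moreover have "f x = remove_sings (\<lambda>z. shift_op s g z - g z) x" for x
  proof -
    have gG: "eventually (\<lambda>z. g z = G z) (at y)" for y
      unfolding g_def using G_mero by (intro eventually_remove_sings_eq_at) (auto simp: meromorphic_on_altdef)
    have "eventually (\<lambda>z. g (z + s) = G (z + s)) (at x)"
      by (subst eventually_at_translate) (rule gG)
    with gG[of x] f_ev[of x] have "eventually (\<lambda>z. f z = shift_op s g z - g z) (at x)"
      by eventually_elim (simp add: shift_op_def)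
    then have "remove_sings f x = remove_sings (\<lambda>z. shift_op s g z - g z) x"
      by (rule remove_sings_cong) simp
    then show ?thesis
      by (simp add: nicely_meromorphic_remove_sings_eq[OF fD(1)])
  qed
  ultimately show ?thesis
    unfolding elliptically_summable_def by blast
qed

end

theorem theorem2p6:
  fixes \<Lambda> :: "complex set" and s :: complex
    and \<alpha> :: "complex set set \<Rightarrow> complex" and f :: "complex \<Rightarrow> complex"
  assumes "is_lattice \<Lambda>"
    and "non_torsion \<Lambda> s"
    and "tau_pinning \<Lambda> s \<alpha>"
    and "f \<in> elliptic_field \<Lambda>"
  shows "elliptically_summable \<Lambda> s f \<longleftrightarrow>
           PanOres0 \<Lambda> s \<alpha> f = 0 \<and> PanOres1 \<Lambda> s \<alpha> f = 0 \<and>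
           (\<forall>\<omega>\<in>tau_orbits \<Lambda> s. \<forall>k\<ge>1. Ores f \<omega> k = 0)"
proof -
  obtain w1 w2 where "complex_lattice \<Lambda> w1 w2"
    using assms(1) by (rule is_latticeE)
  then interpret pinned_torus \<Lambda> w1 w2 s \<alpha>
    using assms(2,3) by (simp add: pinned_torus_def pinned_torus_axioms_def)
  show ?thesis
    using residues_vanish_if_summable[OF assms(4)] summable_if_residues_vanish[OF assms(4)] by blast
qed

end
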